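(* Let $K$ be a field, $R=K[x_1,\ldots,x_n]$, and let $I$ and $J$ be two monomial ideals of $R$ such that $I\cap J=IJ$, with $G(I)=\{m_1,\ldots,m_r\}$, $|G(I)|=r$, and $G(J)=\{m_{r+1},\ldots,m_{r+s}\}$, $|G(J)|=s$. Suppose that the minimal free resolutions of $I$ and $J$ are supported by simplicial complexes $\Delta_I$ and $\Delta_J$ on the vertex sets $\{1,\ldots,r\}$ and $\{r+1,\ldots,r+s\}$ respectively (vertex $j$ corresponding to the generator $m_j$). Then the minimal free resolution of $I+J$ is supported by the simplicial complex $\Delta_I*\Delta_J$ on the vertex set $\{1,\ldots,r+s\}$ (vertex $j$ corresponding to $m_j$).
   Context: A monomial ideal is an ideal generated by monomials; $G(M)$ denotes the unique minimal monomial generating set of a monomial ideal $M$. A minimal free resolution of $M$ means a minimal multigraded free resolution of $R/M$. A simplicial complex $\Delta$ on a finite vertex set $V$ of positive integers is a collection of subsets of $V$ (faces) closed under taking subsets; a face with $k+1$ elements has dimension $k$; a facet is a maximal face, and $\Gamma(\Delta)$ is the set of facets. For $\Delta_1,\Delta_2$ on disjoint vertex sets $V_1,V_2$, the join $\Delta_1*\Delta_2$ is the simplicial complex on $V_1\cup V_2$ with facets $\sigma_1\cup\sigma_2$, $\sigma_1\in\Gamma(\Delta_1)$, $\sigma_2\in\Gamma(\Delta_2)$. The chain complex $\mathcal{C}(\Delta)_{\bullet}$ over $K$ has in homological degree $i$ the $K$-vector space with basis $e_\sigma$, $\sigma\in\Delta$, $|\sigma|=i$ (faces of dimension $i-1$),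 and differential $\partial(e_\sigma)=\sum_{j\in\sigma}\operatorname{sign}(j,\sigma)e_{\sigma\setminus\{j\}}$, where $\operatorname{sign}(j,\sigma)=(-1)^{t-1}$ if $j$ is the $t$-th element of $\sigma$ in increasing order. Let $M$ be a monomial ideal with $G(M)=\{m_v : v\in V\}$, the $m_v$ distinct, and let $\Delta$ be a simplicial complex on $V$ with every $\{v\}$, $v\in V$, a face and $\emptyset\in\Delta$. The $G(M)$-homogenization of $\mathcal{C}(\Delta)_{\bullet}$ is the complex $\mathbb{G}_{\bullet}$ of multigraded free $R$-modules with basis in degree $i$ given by $e_\sigma$, $\sigma\in\Delta$, $|\sigma|=i$, where $e_\sigma$ has multidegree the exponent vector of the monomial $m_\sigma$ defined by $m_\emptyset=1$, $m_{\{v\}}=m_v$, and $m_\sigma=\operatorname{lcm}(m_{\sigma\setminus\{j\}} : j\in\sigma)$ for $|\sigma|\ge 2$, and with differential $e_\sigma\mapsto\sum_{j\in\sigma}\operatorname{sign}(j,\sigma)\frac{m_\sigma}{m_{\sigma\setminus\{j\}}}e_{\sigma\setminus\{j\}}$. A minimal free resolution of $M$ is said to be supported by $\Delta$ if it is isomorphic, as a multigraded complex, to the $G(M)$-homogenization of $\mathcal{C}(\Delta)_{\bullet}$. *)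

theory Defs
  imports Complex_Main "HOL-Library.Poly_Mapping" "HOL-Library.Function_Algebras"
begin

section \<open>Polynomials and monomial ideals\<close>

text \<open>
  The index type \<open>'n\<close> of the variables is finite, with \<open>n = CARD('n)\<close>. Monomials are given by their
  exponent vectors \<open>'n \<Rightarrow> nat\<close>; with the pointwise structure on functions, \<open>+\<close> is multiplication of
  monomials, \<open>\<le>\<close> divisibility, \<open>sup\<close> the lcm and \<open>-\<close> the quotient (when it exists).
  The polynomial ring is the monoid algebra of these exponent vectors.
\<close>

type_synonym ('n, 'k) mpoly = "('n \<Rightarrow> nat) \<Rightarrow>\<^sub>0 'k"

definition mon :: "('n \<Rightarrow> nat) \<Rightarrow> ('n, 'k::field) mpoly" where
  "mon a = Poly_Mapping.single a 1"

definition var :: "'n \<Rightarrow> ('n, 'k::field) mpoly" where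
  "var i = mon (\<lambda>j. if j = i then 1 else 0)"

abbreviation ideal_gen :: "'a::comm_ring_1 set \<Rightarrow> 'a set" where
  "ideal_gen S \<equiv> module.span (*) S"

definition ideal_prod :: "'a::comm_ring_1 set \<Rightarrow> 'a set \<Rightarrow> 'a set" where
  "ideal_prod I J = ideal_gen {a * b | a b. a \<in> I \<and> b \<in> J}"

definition ideal_sum :: "'a::comm_ring_1 set \<Rightarrow> 'a set \<Rightarrow> 'a set" where
  "ideal_sum I J = {a + b | a b. a \<in> I \<and> b \<in> J}"

definition monomial_ideal :: "('n::finite, 'k::field) mpoly set \<Rightarrow> bool" where
  "monomial_ideal M \<longleftrightarrow> (\<exists>A. M = ideal_gen (mon ` A))"

text \<open>\<open>minimal_monomial_gens M A\<close> says that \<open>G(M)\<close> is the set of monomials with exponents in \<open>A\<close>.\<close>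

definition minimal_monomial_gens ::
    "('n::finite, 'k::field) mpoly set \<Rightarrow> ('n \<Rightarrow> nat) set \<Rightarrow> bool" where
  "minimal_monomial_gens M A \<longleftrightarrow>
     ideal_gen (mon ` A) = M \<and> (\<forall>A'. A' \<subset> A \<longrightarrow> ideal_gen (mon ` A') \<noteq> M)"

section \<open>Multigraded complexes of free modules\<close>

text \<open>
  The free module on a finite set \<open>B\<close> consists of the functions vanishing outside \<open>B\<close>.
\<close>

definition free_mod :: "'b set \<Rightarrow> ('b \<Rightarrow> ('n, 'k::field) mpoly) set" where
  "free_mod B = {x. \<forall>b. b \<notin> B \<longrightarrow> x b = 0}"

definition smult :: "('n, 'k::field) mpoly \<Rightarrow> ('b \<Rightarrow> ('n, 'k) mpoly) \<Rightarrow> 'b \<Rightarrow> ('n, 'k) mpoly" where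
  "smult p x = (\<lambda>b. p * x b)"

definition unit_vec :: "'b \<Rightarrow> 'b \<Rightarrow> ('n, 'k::field) mpoly" where
  "unit_vec b = (\<lambda>c. if c = b then 1 else 0)"

text \<open>
  The component of multidegree \<open>a\<close> of the free module on \<open>B\<close> whose basis element \<open>b\<close>
  has multidegree \<open>\<delta> b\<close>.
\<close>

definition graded_part ::
    "'b set \<Rightarrow> ('b \<Rightarrow> 'n \<Rightarrow> nat) \<Rightarrow> ('n \<Rightarrow> nat) \<Rightarrow> ('b \<Rightarrow> ('n, 'k::field) mpoly) set" where
  "graded_part B \<delta> a =
     {x \<in> free_mod B. \<forall>b \<in> B. \<forall>c \<in> Poly_Mapping.keys (x b). c + \<delta> b = a}"

definition multigraded_hom ::
    "'b set \<Rightarrow> ('b \<Rightarrow> 'n \<Rightarrow> nat) \<Rightarrow> 'c set \<Rightarrow> ('c \<Rightarrow> 'n \<Rightarrow> nat) \<Rightarrow>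
     (('b \<Rightarrow> ('n, 'k::field) mpoly) \<Rightarrow> 'c \<Rightarrow> ('n, 'k) mpoly) \<Rightarrow> bool" where
  "multigraded_hom B \<delta> C \<epsilon> f \<longleftrightarrow>
     (\<forall>x \<in> free_mod B. f x \<in> free_mod C) \<and>
     (\<forall>x \<in> free_mod B. \<forall>y \<in> free_mod B. f (x + y) = f x + f y) \<and>
     (\<forall>p. \<forall>x \<in> free_mod B. f (smult p x) = smult p (f x)) \<and>
     (\<forall>a. \<forall>x \<in> graded_part B \<delta> a. f x \<in> graded_part C \<epsilon> a)"

text \<open>
  \<open>bdry F i\<close> is the differential from degree \<open>i\<close> to degree \<open>i - 1\<close>; it is only used for \<open>i \<ge> 1\<close>.
\<close>

record (overloaded) ('b, 'n, 'k::zero) mg_complex =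
  basis :: "nat \<Rightarrow> 'b set"
  mdeg :: "nat \<Rightarrow> 'b \<Rightarrow> 'n \<Rightarrow> nat"
  bdry :: "nat \<Rightarrow> ('b \<Rightarrow> ('n \<Rightarrow> nat) \<Rightarrow>\<^sub>0 'k) \<Rightarrow> 'b \<Rightarrow> ('n \<Rightarrow> nat) \<Rightarrow>\<^sub>0 'k"

abbreviation cmod :: "('b, 'n, 'k::field) mg_complex \<Rightarrow> nat \<Rightarrow> ('b \<Rightarrow> ('n, 'k) mpoly) set" where
  "cmod F i \<equiv> free_mod (basis F i)"

definition multigraded_complex :: "('b, 'n::finite, 'k::field) mg_complex \<Rightarrow> bool" where
  "multigraded_complex F \<longleftrightarrow>
     (\<forall>i. finite (basis F i)) \<and>
     (\<forall>i. multigraded_hom (basis F (Suc i)) (mdeg F (Suc i)) (basis F i) (mdeg F i)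
            (bdry F (Suc i))) \<and>
     (\<forall>i. \<forall>x \<in> cmod F (Suc (Suc i)). bdry F (Suc i) (bdry F (Suc (Suc i)) x) = 0)"

definition multigraded_iso ::
    "('b, 'n::finite, 'k::field) mg_complex \<Rightarrow> ('c, 'n, 'k) mg_complex \<Rightarrow> bool" where
  "multigraded_iso F G \<longleftrightarrow>
     (\<exists>\<phi>. (\<forall>i. multigraded_hom (basis F i) (mdeg F i) (basis G i) (mdeg G i) (\<phi> i) \<and>
               bij_betw (\<phi> i) (cmod F i) (cmod G i)) \<and>
          (\<forall>i. \<forall>x \<in> cmod F (Suc i). bdry G (Suc i) (\<phi> (Suc i) x) = \<phi> i (bdry F (Suc i) x)))"

section \<open>Minimal free resolutions\<close>

definition coset :: "'a::comm_ring_1 set \<Rightarrow> 'a \<Rightarrow> 'a set" where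
  "coset M p = {p + q | q. q \<in> M}"

text \<open>
  \<open>\<epsilon>\<close> is a surjective multigraded \<open>R\<close>-linear map from \<open>F\<^sub>0\<close> to \<open>R/M\<close> (whose elements are
  the cosets of \<open>M\<close>), with kernel the image of \<open>F\<^sub>1\<close>.
\<close>

definition augmentation ::
    "('n::finite, 'k::field) mpoly set \<Rightarrow> ('b, 'n, 'k) mg_complex \<Rightarrow>
     (('b \<Rightarrow> ('n, 'k) mpoly) \<Rightarrow> ('n, 'k) mpoly set) \<Rightarrow> bool" where
  "augmentation M F \<epsilon> \<longleftrightarrow>
     \<epsilon> ` cmod F 0 = range (coset M) \<and>
     (\<forall>x \<in> cmod F 0. \<forall>y \<in> cmod F 0. \<forall>p \<in> \<epsilon> x. \<forall>q \<in> \<epsilon> y. \<epsilon> (x + y) = coset M (p + q)) \<and>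
     (\<forall>r. \<forall>x \<in> cmod F 0. \<forall>p \<in> \<epsilon> x. \<epsilon> (smult r x) = coset M (r * p)) \<and>
     (\<forall>a. \<forall>x \<in> graded_part (basis F 0) (mdeg F 0) a.
        \<exists>p. Poly_Mapping.keys p \<subseteq> {a} \<and> \<epsilon> x = coset M p) \<and>
     {x \<in> cmod F 0. \<epsilon> x = coset M 0} = bdry F 1 ` cmod F 1"

definition free_resolution ::
    "('n::finite, 'k::field) mpoly set \<Rightarrow> ('b, 'n, 'k) mg_complex \<Rightarrow> bool" where
  "free_resolution M F \<longleftrightarrow>
     multigraded_complex F \<and>
     (\<forall>i. {x \<in> cmod F (Suc i). bdry F (Suc i) x = 0}
            = bdry F (Suc (Suc i)) ` cmod F (Suc (Suc i))) \<and>
     (\<exists>\<epsilon>. augmentation M F \<epsilon>)"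

text \<open>
  Following the usual convention, a minimal free resolution of \<open>M\<close> resolves \<open>R/M\<close>. Minimality is
  \<open>\<partial>(F\<^sub>i) \<subseteq> (x\<^sub>1,\<dots>,x\<^sub>n) F\<^sub>i\<^sub>-\<^sub>1\<close> for \<open>i \<ge> 1\<close>.
\<close>

definition minimal_free_resolution ::
    "('n::finite, 'k::field) mpoly set \<Rightarrow> ('b, 'n, 'k) mg_complex \<Rightarrow> bool" where
  "minimal_free_resolution M F \<longleftrightarrow>
     free_resolution M F \<and>
     (\<forall>i. \<forall>x \<in> cmod F (Suc i). \<forall>b \<in> basis F i. bdry F (Suc i) x b \<in> ideal_gen (range var))"

section \<open>Simplicial complexes and homogenization\<close>

definition simplicial_complex :: "nat set \<Rightarrow> nat set set \<Rightarrow> bool" where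
  "simplicial_complex V \<Delta> \<longleftrightarrow>
     finite V \<and> 0 \<notin> V \<and> (\<forall>\<sigma> \<in> \<Delta>. \<sigma> \<subseteq> V) \<and> (\<forall>\<sigma> \<in> \<Delta>. \<forall>\<tau>. \<tau> \<subseteq> \<sigma> \<longrightarrow> \<tau> \<in> \<Delta>)"

definition facets :: "nat set set \<Rightarrow> nat set set" where
  "facets \<Delta> = {\<sigma> \<in> \<Delta>. \<forall>\<tau> \<in> \<Delta>. \<sigma> \<subseteq> \<tau> \<longrightarrow> \<tau> = \<sigma>}"

definition join :: "nat set set \<Rightarrow> nat set set \<Rightarrow> nat set set" where
  "join \<Delta>\<^sub>1 \<Delta>\<^sub>2 = {\<tau>. \<exists>\<sigma>\<^sub>1 \<in> facets \<Delta>\<^sub>1. \<exists>\<sigma>\<^sub>2 \<in> facets \<Delta>\<^sub>2. \<tau> \<subseteq> \<sigma>\<^sub>1 \<union> \<sigma>\<^sub>2}"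

text \<open>If \<open>j\<close> is the \<open>t\<close>-th element of \<open>\<sigma>\<close>, then \<open>t - 1\<close> elements of \<open>\<sigma>\<close> are smaller than \<open>j\<close>.\<close>

definition face_sign :: "nat \<Rightarrow> nat set \<Rightarrow> ('n, 'k::field) mpoly" where
  "face_sign j \<sigma> = (-1) ^ card {i \<in> \<sigma>. i < j}"

text \<open>
  The exponent vector of \<open>m\<^sub>\<sigma>\<close>; the (irrelevant) value for infinite \<open>\<sigma>\<close> is that for the empty face.
\<close>

function face_deg :: "(nat \<Rightarrow> 'n \<Rightarrow> nat) \<Rightarrow> nat set \<Rightarrow> 'n \<Rightarrow> nat" where
  "face_deg m \<sigma> =
     (if card \<sigma> = 0 then 0
      else if card \<sigma> = 1 then m (the_elem \<sigma>)
      else Sup_fin ((\<lambda>j. face_deg m (\<sigma> - {j})) ` \<sigma>))"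
  by pat_completeness auto
termination
  by (relation "measure (\<lambda>(m, \<sigma>). card \<sigma>)") (auto simp: card_gt_0_iff intro: card_Diff1_less)

declare face_deg.simps [simp del]

definition face_bdry :: "(nat \<Rightarrow> 'n \<Rightarrow> nat) \<Rightarrow> nat set \<Rightarrow> nat set \<Rightarrow> ('n, 'k::field) mpoly" where
  "face_bdry m \<sigma> =
     (\<Sum>j\<in>\<sigma>. smult (face_sign j \<sigma> * mon (face_deg m \<sigma> - face_deg m (\<sigma> - {j})))
                    (unit_vec (\<sigma> - {j})))"

text \<open>The homogenization of the chain complex of \<open>\<Delta>\<close> by the monomials with exponents \<open>m v\<close>.\<close>

definition homogenization ::
    "(nat \<Rightarrow> 'n::finite \<Rightarrow> nat) \<Rightarrow> nat set set \<Rightarrow> (nat set, 'n, 'k::field) mg_complex" where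
  "homogenization m \<Delta> =
     \<lparr> basis = (\<lambda>i. {\<sigma> \<in> \<Delta>. card \<sigma> = i}),
       mdeg = (\<lambda>_. face_deg m),
       bdry = (\<lambda>i x. \<Sum>\<sigma> \<in> {\<sigma> \<in> \<Delta>. card \<sigma> = i}. smult (x \<sigma>) (face_bdry m \<sigma>)) \<rparr>"

text \<open>
  \<open>supported_by M V m \<Delta> F\<close>: the complex \<open>F\<close> (meant to be a minimal free resolution of \<open>M\<close>) is
  supported by \<open>\<Delta>\<close>, where vertex \<open>v \<in> V\<close> corresponds to the minimal generator with exponent \<open>m v\<close>.
  That \<open>m\<close> labels \<open>V\<close> bijectively by \<open>G(M)\<close> and that \<open>\<Delta>\<close> is a simplicial complex containing all
  the vertices is part of the notion.
\<close>

definition supported_by ::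
    "('n::finite, 'k::field) mpoly set \<Rightarrow> nat set \<Rightarrow> (nat \<Rightarrow> 'n \<Rightarrow> nat) \<Rightarrow> nat set set \<Rightarrow>
     ('b, 'n, 'k) mg_complex \<Rightarrow> bool" where
  "supported_by M V m \<Delta> F \<longleftrightarrow>
     inj_on m V \<and> minimal_monomial_gens M (m ` V) \<and>
     simplicial_complex V \<Delta> \<and> {} \<in> \<Delta> \<and> (\<forall>v \<in> V. {v} \<in> \<Delta>) \<and>
     multigraded_iso F (homogenization m \<Delta>)"

end

theory Submission
  imports Defs
begin

text \<open>
  Let \<open>\<Delta>\<close> be the join of \<open>\<Delta>\<^sub>I\<close> and \<open>\<Delta>\<^sub>J\<close>. In multidegree \<open>a\<close>, the homogenization of
  a complex is the chain complex over \<open>K\<close> of the subcomplex of faces \<open>\<sigma>\<close> with \<open>m\<^sub>\<sigma>\<close> dividing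
  \<open>x\<^sup>a\<close>, so it resolves iff all these subcomplexes have no homology in degrees \<open>\<ge> 1\<close>. The subcomplex
  of \<open>\<Delta>\<close> belonging to \<open>a\<close> is the join of those of \<open>\<Delta>\<^sub>I\<close> and \<open>\<Delta>\<^sub>J\<close>, and the join with an acyclic
  complex is acyclic; hence the homogenization of \<open>\<Delta>\<close> is a resolution. The hypothesis
  \<open>I \<inter> J = IJ\<close> forces the generators of \<open>I\<close> and \<open>J\<close> to involve disjoint sets of variables, which
  gives minimality.
\<close>

section \<open>Chain complexes of simplicial complexes and joins\<close>

text \<open>The obstacle is degree 0. If no generator of \<open>I\<close> divides
  \<open>x^a\<close>, the subcomplex of \<open>a\<close> has only the empty face and its degree 0
  homology is \<open>K\<close>, so the factors need not be acyclic in all degrees. But as soon as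
  the first factor has a vertex it is acyclic in every degree and makes the join acyclic; without a
  vertex it leaves just the other factor. Instead of a Kuenneth formula, a cycle is filtered by its
  number of vertices in the second block, and its top layer is removed slice by slice. The first
  block precedes the second, so the signs on a slice are those of the first factor. Minimality
  becomes combinatorial too: no entry of the differential is a unit iff removing a vertex from a
  face always lowers its lcm. The join inherits this, because an exponent lost in one block cannot
  be supplied by labels of the other block that avoid the same variable.\<close>

text \<open>
  Chains are coefficient functions on faces; the coefficient of \<open>\<tau>\<close> in the boundary collects the
  faces \<open>\<tau> \<union> {j}\<close>, and \<open>V\<close> only has to contain all vertices that occur. Degrees are
  cardinalities, so degree 0 is the augmentation.
\<close>

definition chain_bdry :: "nat set \<Rightarrow> (nat set \<Rightarrow> 'k::comm_ring_1) \<Rightarrow> nat set \<Rightarrow> 'k" where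
  "chain_bdry V c \<tau> = (\<Sum>j\<in>V - \<tau>. (-1) ^ card {i \<in> \<tau>. i < j} * c (insert j \<tau>))"

definition chains :: "nat set set \<Rightarrow> nat \<Rightarrow> (nat set \<Rightarrow> 'k::comm_ring_1) set" where
  "chains \<Gamma> n = {c. \<forall>\<sigma>. c \<sigma> \<noteq> 0 \<longrightarrow> \<sigma> \<in> \<Gamma> \<and> card \<sigma> = n}"

text \<open>Homology may depend on the coefficients, and no other argument mentions
  \<open>'k\<close>; the token \<open>T\<close> fixes it.\<close>

definition acyclic_at :: "'k::comm_ring_1 itself \<Rightarrow> nat set \<Rightarrow> nat set set \<Rightarrow> nat \<Rightarrow> bool" where
  "acyclic_at T V \<Gamma> n \<longleftrightarrow>
     (\<forall>c \<in> chains \<Gamma> n. chain_bdry V c = 0 \<longrightarrow> (\<exists>w \<in> chains \<Gamma> (Suc n). chain_bdry V w = (c :: nat set \<Rightarrow> 'k)))"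

section \<open>Faces, chains and the square of the boundary\<close>

lemma simplicial_complex_downD:
  "simplicial_complex V \<Delta> \<Longrightarrow> \<sigma> \<in> \<Delta> \<Longrightarrow> \<tau> \<subseteq> \<sigma> \<Longrightarrow> \<tau> \<in> \<Delta>"
  by (auto simp: simplicial_complex_def)

lemma simplicial_complex_subset: "simplicial_complex V \<Delta> \<Longrightarrow> \<sigma> \<in> \<Delta> \<Longrightarrow> \<sigma> \<subseteq> V"
  by (auto simp: simplicial_complex_def)

lemma simplicial_complex_finite: "simplicial_complex V \<Delta> \<Longrightarrow> \<sigma> \<in> \<Delta> \<Longrightarrow> finite \<sigma>"
  by (auto simp: simplicial_complex_def intro: finite_subset)

lemma simplicial_complex_finite_faces:
  assumes "simplicial_complex V \<Delta>" shows "finite \<Delta>"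
  by (rule finite_subset[of _ "Pow V"]) (use assms in \<open>auto simp: simplicial_complex_def\<close>)

lemma zero_in_chains [simp]: "0 \<in> chains \<Gamma> n"
  by (simp add: chains_def)

lemma chains_mono: "\<Gamma> \<subseteq> \<Gamma>' \<Longrightarrow> chains \<Gamma> n \<subseteq> chains \<Gamma>' n"
  by (auto simp: chains_def)

lemma chains_add: "c \<in> chains \<Gamma> n \<Longrightarrow> d \<in> chains \<Gamma> n \<Longrightarrow> c + d \<in> chains \<Gamma> n"
  unfolding chains_def plus_fun_apply mem_Collect_eq by (metis add.right_neutral)

lemma chains_diff: "c \<in> chains \<Gamma> n \<Longrightarrow> d \<in> chains \<Gamma> n \<Longrightarrow> c - d \<in> chains \<Gamma> n"
  unfolding chains_def fun_diff_def mem_Collect_eq by (metis diff_zero)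

lemma chain_bdry_add: "chain_bdry V (c + d) = chain_bdry V c + chain_bdry V d"
  by (rule ext) (simp add: chain_bdry_def algebra_simps sum.distrib)

lemma chain_bdry_diff: "chain_bdry V (c - d) = chain_bdry V c - chain_bdry V d"
  by (rule ext) (simp add: chain_bdry_def algebra_simps sum_subtractf)

lemma chain_bdry_zero [simp]: "chain_bdry V 0 = 0"
  by (rule ext) (simp add: chain_bdry_def)

lemma chain_bdry_in_chains:
  assumes "c \<in> chains \<Gamma> (Suc n)" "simplicial_complex V \<Gamma>"
  shows "chain_bdry V c \<in> chains \<Gamma> n"
  unfolding chains_def mem_Collect_eq
proof (intro allI impI)
  fix \<tau> assume "chain_bdry V c \<tau> \<noteq> 0"
  then obtain j where j: "j \<in> V - \<tau>" "c (insert j \<tau>) \<noteq> 0"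
    unfolding chain_bdry_def by (force elim: sum.not_neutral_contains_not_neutral)
  then have "insert j \<tau> \<in> \<Gamma>" "card (insert j \<tau>) = Suc n"
    using assms(1) by (auto simp: chains_def)
  moreover then have "finite \<tau>"
    using simplicial_complex_finite[OF assms(2), of "insert j \<tau>"] by simp
  moreover have "\<tau> \<in> \<Gamma>"
    using simplicial_complex_downD[OF assms(2) \<open>insert j \<tau> \<in> \<Gamma>\<close>] by blast
  ultimately show "\<tau> \<in> \<Gamma> \<and> card \<tau> = n" using j(1) by simp
qed

lemma card_below_insert:
  fixes j k :: nat
  assumes "k \<notin> \<tau>"
  shows "card {i \<in> insert k \<tau>. i < j} = card {i \<in> \<tau>. i < j} + (if k < j then 1 else 0)"
proof (cases "k < j")
  case True
  then have "{i \<in> insert k \<tau>. i < j} = insert k {i \<in> \<tau>. i < j}" by auto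
  then show ?thesis using True assms by simp
next
  case False
  then have "{i \<in> insert k \<tau>. i < j} = {i \<in> \<tau>. i < j}" by auto
  then show ?thesis using False by simp
qed

text \<open>Pairing \<open>(j, k)\<close> with \<open>(k, j)\<close> avoids dividing by 2, so characteristic 2 is covered.\<close>

lemma sum_antisymmetric:
  fixes g :: "'a::linorder \<Rightarrow> 'a \<Rightarrow> 'b::ab_group_add"
  assumes "finite W" and anti: "\<And>j k. j \<in> W \<Longrightarrow> k \<in> W \<Longrightarrow> j < k \<Longrightarrow> g k j = - g j k"
  shows "(\<Sum>j\<in>W. \<Sum>k\<in>W - {j}. g j k) = 0"
proof -
  have "(\<Sum>j\<in>W. \<Sum>k\<in>W - {j}. g j k) = (\<Sum>j\<in>W. (\<Sum>k\<in>{k\<in>W. j < k}. g j k) + (\<Sum>k\<in>{k\<in>W. k < j}. g j k))"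
  proof (rule sum.cong[OF refl])
    fix j assume "j \<in> W"
    have split: "W - {j} = {k\<in>W. j < k} \<union> {k\<in>W. k < j}" by auto
    show "(\<Sum>k\<in>W - {j}. g j k) = (\<Sum>k\<in>{k\<in>W. j < k}. g j k) + (\<Sum>k\<in>{k\<in>W. k < j}. g j k)"
      unfolding split by (rule sum.union_disjoint) (use assms(1) in auto)
  qed
  also have "\<dots> = (\<Sum>j\<in>W. \<Sum>k\<in>{k\<in>W. j < k}. g j k) + (\<Sum>j\<in>W. \<Sum>k\<in>{k\<in>W. k < j}. g j k)"
    by (rule sum.distrib)
  also have "(\<Sum>j\<in>W. \<Sum>k\<in>{k\<in>W. k < j}. g j k) = (\<Sum>k\<in>W. \<Sum>j\<in>{j\<in>W. k < j}. g j k)"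
    using assms(1) by (rule sum.swap_restrict) (rule assms(1))
  also have "\<dots> = (\<Sum>k\<in>W. \<Sum>j\<in>{j\<in>W. k < j}. - g k j)"
    by (intro sum.cong refl) (auto simp: anti)
  finally show ?thesis by (simp add: sum_negf)
qed

text \<open>Two vertices can be added to \<tau> in either order. The smaller one shifts the position
  of the larger by one and not conversely, so the two contributions cancel.\<close>

lemma chain_bdry_chain_bdry:
  assumes "finite V" shows "chain_bdry V (chain_bdry V c) = 0"
proof
  fix \<tau>
  let ?g = "\<lambda>j k. (-1) ^ card {i \<in> \<tau>. i < j} * ((-1) ^ card {i \<in> insert j \<tau>. i < k} * c (insert k (insert j \<tau>)))"
  have "chain_bdry V (chain_bdry V c) \<tau> = (\<Sum>j\<in>V - \<tau>. \<Sum>k\<in>V - insert j \<tau>. ?g j k)"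
    by (simp only: chain_bdry_def sum_distrib_left)
  also have "\<dots> = (\<Sum>j\<in>V - \<tau>. \<Sum>k\<in>V - \<tau> - {j}. ?g j k)"
    by (intro sum.cong refl) auto
  also have "\<dots> = 0"
  proof (rule sum_antisymmetric)
    fix j k assume jk: "j \<in> V - \<tau>" "k \<in> V - \<tau>" "j < k"
    have "(-1) ^ card {i \<in> insert k \<tau>. i < j} = ((-1) ^ card {i \<in> \<tau>. i < j} :: 'a)"
      using jk by (subst card_below_insert) auto
    moreover have "(-1) ^ card {i \<in> insert j \<tau>. i < k} = (- ((-1) ^ card {i \<in> \<tau>. i < k}) :: 'a)"
      using jk by (subst card_below_insert) auto
    moreover have "insert j (insert k \<tau>) = insert k (insert j \<tau>)" by (rule insert_commute)
    ultimately show "?g k j = - ?g j k" by (simp add: mult.left_commute)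
  qed (use assms in simp)
  finally show "chain_bdry V (chain_bdry V c) \<tau> = 0 \<tau>" by simp
qed

text \<open>A term for \<open>j\<close> outside \<open>V\<close> evaluates the chain at a set that
  is no face. This lets a join whose first factor has no vertex be compared with the second
  factor.\<close>

lemma chain_bdry_vertices_cong:
  assumes "c \<in> chains \<Gamma> n" "\<And>\<sigma>. \<sigma> \<in> \<Gamma> \<Longrightarrow> \<sigma> \<subseteq> V" "V \<subseteq> V'" "finite V'"
  shows "chain_bdry V' c = chain_bdry V c"
proof
  fix \<tau>
  have "c (insert j \<tau>) = 0" if "j \<in> V'" "j \<notin> V" for j
    using assms(1,2) that by (auto simp: chains_def)
  then show "chain_bdry V' c \<tau> = chain_bdry V c \<tau>"
    unfolding chain_bdry_def using assms(3,4) by (intro sum.mono_neutral_right) force+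
qed

text \<open>Membership is described by the two parts of a face rather than by facets, since this
  form survives restriction to the faces below a multidegree, whereas facets change. The order of
  the blocks removes all sign corrections.\<close>

locale ordered_join =
  fixes V1 V2 :: "nat set" and \<Gamma>1 \<Gamma>2 \<Gamma> :: "nat set set"
  assumes complex1: "simplicial_complex V1 \<Gamma>1" and complex2: "simplicial_complex V2 \<Gamma>2"
    and ordered: "i \<in> V1 \<Longrightarrow> j \<in> V2 \<Longrightarrow> i < j"
    and face_iff: "\<sigma> \<in> \<Gamma> \<longleftrightarrow> \<sigma> \<subseteq> V1 \<union> V2 \<and> \<sigma> \<inter> V1 \<in> \<Gamma>1 \<and> \<sigma> \<inter> V2 \<in> \<Gamma>2"
begin

lemma disjoint: "V1 \<inter> V2 = {}"
  using ordered by blast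

lemma finite_vertices: "finite V1" "finite V2"
  using complex1 complex2 by (auto simp: simplicial_complex_def)

lemma complex_join: "simplicial_complex (V1 \<union> V2) \<Gamma>"
proof -
  have "\<tau> \<in> \<Gamma>" if "\<sigma> \<in> \<Gamma>" "\<tau> \<subseteq> \<sigma>" for \<sigma> \<tau>
    using that simplicial_complex_downD[OF complex1, of "\<sigma> \<inter> V1" "\<tau> \<inter> V1"]
      simplicial_complex_downD[OF complex2, of "\<sigma> \<inter> V2" "\<tau> \<inter> V2"]
    unfolding face_iff by blast
  moreover have "finite (V1 \<union> V2)" "0 \<notin> V1 \<union> V2" "\<forall>\<sigma>\<in>\<Gamma>. \<sigma> \<subseteq> V1 \<union> V2"
    using complex1 complex2 by (auto simp: simplicial_complex_def face_iff)
  ultimately show ?thesis unfolding simplicial_complex_def by blast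
qed

text \<open>By \<open>top\<close>, only new vertices from \<open>V1\<close> contribute, and all
  elements of \<tau> are larger than these, so they do not affect the signs.\<close>

lemma chain_bdry_split:
  assumes "\<rho> \<subseteq> V1" "\<tau> \<subseteq> V2" and top: "\<And>j. j \<in> V2 - \<tau> \<Longrightarrow> c (insert j (\<rho> \<union> \<tau>)) = 0"
  shows "chain_bdry (V1 \<union> V2) c (\<rho> \<union> \<tau>) = chain_bdry V1 (\<lambda>\<rho>. c (\<rho> \<union> \<tau>)) \<rho>"
proof -
  have "chain_bdry (V1 \<union> V2) c (\<rho> \<union> \<tau>)
      = (\<Sum>j\<in>V1 - \<rho>. (-1) ^ card {i \<in> \<rho> \<union> \<tau>. i < j} * c (insert j (\<rho> \<union> \<tau>)))"
    unfolding chain_bdry_def using assms disjoint finite_vertices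
    by (intro sum.mono_neutral_right) auto
  also have "\<dots> = chain_bdry V1 (\<lambda>\<rho>. c (\<rho> \<union> \<tau>)) \<rho>"
    unfolding chain_bdry_def
  proof (intro sum.cong refl arg_cong2[where f = "(*)"])
    fix j assume "j \<in> V1 - \<rho>"
    then have "{i \<in> \<rho> \<union> \<tau>. i < j} = {i \<in> \<rho>. i < j}"
      using ordered assms(2) by (fastforce dest: less_asym)
    then show "(-1) ^ card {i \<in> \<rho> \<union> \<tau>. i < j} = ((-1) ^ card {i \<in> \<rho>. i < j} :: 'a)" by simp
  qed auto
  finally show ?thesis .
qed

text \<open>The cut to subsets of \<open>V1\<close> matters: if \<rho> meets \<tau>, then
  \<open>\<rho> \<union> \<tau>\<close> may be a face of \<open>\<Gamma>\<close> although \<rho> is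
  no face of \<open>\<Gamma>1\<close>.\<close>

lemma slice_in_chains:
  assumes "c \<in> chains \<Gamma> n" "\<tau> \<subseteq> V2" "finite \<tau>"
  shows "(\<lambda>\<rho>. if \<rho> \<subseteq> V1 then c (\<rho> \<union> \<tau>) else 0) \<in> chains \<Gamma>1 (n - card \<tau>)"
  unfolding chains_def mem_Collect_eq
proof (intro allI impI)
  fix \<rho> assume "(if \<rho> \<subseteq> V1 then c (\<rho> \<union> \<tau>) else 0) \<noteq> 0"
  then have \<rho>: "\<rho> \<subseteq> V1" "c (\<rho> \<union> \<tau>) \<noteq> 0" by (auto split: if_splits)
  then have "\<rho> \<union> \<tau> \<in> \<Gamma>" "card (\<rho> \<union> \<tau>) = n" using assms(1) by (auto simp: chains_def)
  moreover have "(\<rho> \<union> \<tau>) \<inter> V1 = \<rho>" "\<rho> \<inter> \<tau> = {}" using \<rho> assms(2) disjoint by auto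
  moreover have "finite \<rho>" using \<rho> finite_vertices finite_subset by blast
  ultimately show "\<rho> \<in> \<Gamma>1 \<and> card \<rho> = n - card \<tau>"
    using assms(3) card_Un_disjoint[of \<rho> \<tau>] by (auto simp: face_iff)
qed

text \<open>
  Filter by \<open>card (\<sigma> \<inter> V2)\<close>: for \<open>\<tau>\<close> of the largest occurring cardinality \<open>k\<close>, the slice
  \<open>\<rho> \<mapsto> c (\<rho> \<union> \<tau>)\<close> is a cycle of \<open>\<Gamma>1\<close>. The chain \<open>W\<close> assembled from bounding chains of these
  slices reduces \<open>c\<close> to a cycle in a smaller filtration step.
\<close>

lemma acyclic_filtered:
  assumes "\<And>i. acyclic_at TYPE('k::field) V1 \<Gamma>1 i"
    and "c \<in> chains \<Gamma> n" "chain_bdry (V1 \<union> V2) c = 0"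
    and "\<And>\<sigma>. c \<sigma> \<noteq> 0 \<Longrightarrow> card (\<sigma> \<inter> V2) < k"
  shows "\<exists>w \<in> chains \<Gamma> (Suc n). chain_bdry (V1 \<union> V2) w = (c :: nat set \<Rightarrow> 'k)"
  using assms(2-)
proof (induction k arbitrary: c)
  case 0
  then have "c = 0" by (intro ext) auto
  then show ?case using chain_bdry_zero zero_in_chains by metis
next
  case (Suc k)
  show ?case
  proof (cases "k \<le> n")
    \<comment> \<open>Here \<open>n - k\<close> would be truncated. But a face with \<open>n\<close>
      vertices has fewer than \<open>k\<close> of them in \<open>V2\<close>, so the induction
      hypothesis applies to \<open>c\<close> itself.\<close>
    case False
    have "card (\<sigma> \<inter> V2) < k" if "c \<sigma> \<noteq> 0" for \<sigma>
    proof -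
      have "\<sigma> \<in> \<Gamma>" "card \<sigma> = n" using Suc.prems(1) that by (auto simp: chains_def)
      then have "card (\<sigma> \<inter> V2) \<le> n"
        using card_mono[of \<sigma> "\<sigma> \<inter> V2"] simplicial_complex_finite[OF complex_join] by auto
      then show ?thesis using False by simp
    qed
    then show ?thesis using Suc by blast
  next
    case True
    have slice: "\<exists>w. w \<in> chains \<Gamma>1 (Suc (n - k)) \<and> (\<forall>\<rho>\<subseteq>V1. chain_bdry V1 w \<rho> = c (\<rho> \<union> \<tau>))"
      if \<tau>: "\<tau> \<in> \<Gamma>2" "card \<tau> = k" for \<tau>
    proof -
      have sub: "\<tau> \<subseteq> V2" and fin: "finite \<tau>"
        using \<tau> simplicial_complex_subset[OF complex2] simplicial_complex_finite[OF complex2] by auto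
      define d where "d = (\<lambda>\<rho>. if \<rho> \<subseteq> V1 then c (\<rho> \<union> \<tau>) else 0)"
      have d: "d \<in> chains \<Gamma>1 (n - k)"
        unfolding d_def using slice_in_chains[OF Suc.prems(1) sub fin] \<tau>(2) by simp
      have "chain_bdry V1 d \<rho> = 0" for \<rho>
      proof (cases "\<rho> \<subseteq> V1")
        case True
        \<comment> \<open>One more vertex of \<open>V2\<close> would lead above the top layer, where
          \<open>c\<close> vanishes.\<close>
        have top: "c (insert j (\<rho> \<union> \<tau>)) = 0" if "j \<in> V2 - \<tau>" for j
        proof (rule ccontr)
          assume "c (insert j (\<rho> \<union> \<tau>)) \<noteq> 0"
          then have "card (insert j (\<rho> \<union> \<tau>) \<inter> V2) < Suc k" by (rule Suc.prems)
          moreover have "insert j (\<rho> \<union> \<tau>) \<inter> V2 = insert j \<tau>" using True that sub disjoint by auto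
          ultimately show False using that fin \<tau>(2) by simp
        qed
        have "chain_bdry V1 d \<rho> = chain_bdry V1 (\<lambda>\<rho>. c (\<rho> \<union> \<tau>)) \<rho>"
          unfolding chain_bdry_def d_def using True by (intro sum.cong) auto
        also have "\<dots> = chain_bdry (V1 \<union> V2) c (\<rho> \<union> \<tau>)"
          by (rule chain_bdry_split[symmetric]) (use True sub top in auto)
        finally show ?thesis using Suc.prems(2) by simp
      qed (auto simp: chain_bdry_def d_def)
      then have "chain_bdry V1 d = 0" by auto
      then obtain w where "w \<in> chains \<Gamma>1 (Suc (n - k))" "chain_bdry V1 w = d"
        using assms(1) d unfolding acyclic_at_def by blast
      then show ?thesis by (auto simp: d_def)
    qed
    define w where "w \<tau> = (SOME w. w \<in> chains \<Gamma>1 (Suc (n - k)) \<and> (\<forall>\<rho>\<subseteq>V1. chain_bdry V1 w \<rho> = c (\<rho> \<union> \<tau>)))" for \<tau>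
    have w: "w \<tau> \<in> chains \<Gamma>1 (Suc (n - k))" "\<rho> \<subseteq> V1 \<Longrightarrow> chain_bdry V1 (w \<tau>) \<rho> = c (\<rho> \<union> \<tau>)"
      if "\<tau> \<in> \<Gamma>2" "card \<tau> = k" for \<tau> \<rho>
      using someI_ex[OF slice[OF that]] unfolding w_def[symmetric] by auto
    \<comment> \<open>A face is cut into its two parts; the chain chosen for the
      \<open>V2\<close>-part is evaluated at the \<open>V1\<close>-part.\<close>
    define W where "W \<sigma> = (if \<sigma> \<subseteq> V1 \<union> V2 \<and> \<sigma> \<inter> V2 \<in> \<Gamma>2 \<and> card (\<sigma> \<inter> V2) = k then w (\<sigma> \<inter> V2) (\<sigma> \<inter> V1) else 0)" for \<sigma>
    have W: "W \<in> chains \<Gamma> (Suc n)"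
      unfolding chains_def mem_Collect_eq
    proof (intro allI impI)
      fix \<sigma> assume "W \<sigma> \<noteq> 0"
      then have \<sigma>: "\<sigma> \<subseteq> V1 \<union> V2" "\<sigma> \<inter> V2 \<in> \<Gamma>2" "card (\<sigma> \<inter> V2) = k" "w (\<sigma> \<inter> V2) (\<sigma> \<inter> V1) \<noteq> 0"
        by (auto simp: W_def split: if_splits)
      then have "\<sigma> \<inter> V1 \<in> \<Gamma>1" "card (\<sigma> \<inter> V1) = Suc (n - k)" using w(1)[of "\<sigma> \<inter> V2"] by (auto simp: chains_def)
      moreover have "\<sigma> = (\<sigma> \<inter> V1) \<union> (\<sigma> \<inter> V2)" using \<sigma> by auto
      then have "card \<sigma> = card (\<sigma> \<inter> V1) + card (\<sigma> \<inter> V2)"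
        by (metis card_Un_disjoint disjoint finite_Int finite_vertices inf_assoc inf_bot_right inf_left_commute)
      ultimately show "\<sigma> \<in> \<Gamma> \<and> card \<sigma> = Suc n" using \<sigma> True by (auto simp: face_iff)
    qed
    define c' where "c' = c - chain_bdry (V1 \<union> V2) W"
    have bW: "chain_bdry (V1 \<union> V2) W \<in> chains \<Gamma> n" by (rule chain_bdry_in_chains[OF W complex_join])
    have c': "c' \<in> chains \<Gamma> n" unfolding c'_def by (rule chains_diff[OF Suc.prems(1) bW])
    have "chain_bdry (V1 \<union> V2) c' = 0"
      unfolding c'_def chain_bdry_diff Suc.prems(2)
      using chain_bdry_chain_bdry[of "V1 \<union> V2" W] finite_vertices by simp
    \<comment> \<open>Removing a vertex of \<open>V1\<close> from a face of \<open>W\<close> stays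
      in layer \<open>k\<close>, removing one of \<open>V2\<close> drops to layer
      \<open>k - 1\<close>. So in layer \<open>k\<close> only the \<open>V1\<close>-boundary is
      seen, which is \<open>c\<close>, and above it \<open>W\<close> contributes nothing.\<close>
    moreover have "card (\<sigma> \<inter> V2) < k" if "c' \<sigma> \<noteq> 0" for \<sigma>
    proof (rule ccontr)
      assume *: "\<not> card (\<sigma> \<inter> V2) < k"
      have \<sigma>: "\<sigma> \<in> \<Gamma>" using c' that by (auto simp: chains_def)
      then have sub: "\<sigma> \<subseteq> V1 \<union> V2" "\<sigma> \<inter> V2 \<in> \<Gamma>2" by (auto simp: face_iff)
      have fin: "finite (\<sigma> \<inter> V2)" using finite_vertices by auto
      have \<sigma>_eq: "(\<sigma> \<inter> V1) \<union> (\<sigma> \<inter> V2) = \<sigma>" using sub by auto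
      have top: "W (insert j \<sigma>) = 0" if "j \<in> V2 - \<sigma>" for j
      proof -
        have "insert j \<sigma> \<inter> V2 = insert j (\<sigma> \<inter> V2)" using that by auto
        then have "card (insert j \<sigma> \<inter> V2) > k" using * that fin by simp
        then show ?thesis by (simp add: W_def)
      qed
      have "chain_bdry (V1 \<union> V2) W ((\<sigma> \<inter> V1) \<union> (\<sigma> \<inter> V2)) = chain_bdry V1 (\<lambda>\<rho>. W (\<rho> \<union> (\<sigma> \<inter> V2))) (\<sigma> \<inter> V1)"
        by (rule chain_bdry_split) (use top \<sigma>_eq in auto)
      also have "\<dots> = (if card (\<sigma> \<inter> V2) = k then c \<sigma> else 0)"
      proof -
        have "W (insert j (\<sigma> \<inter> V1) \<union> (\<sigma> \<inter> V2)) = (if card (\<sigma> \<inter> V2) = k then w (\<sigma> \<inter> V2) (insert j (\<sigma> \<inter> V1)) else 0)"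
          if "j \<in> V1" for j
        proof -
          have "(insert j (\<sigma> \<inter> V1) \<union> (\<sigma> \<inter> V2)) \<inter> V2 = \<sigma> \<inter> V2" "(insert j (\<sigma> \<inter> V1) \<union> (\<sigma> \<inter> V2)) \<inter> V1 = insert j (\<sigma> \<inter> V1)"
            using that disjoint by auto
          moreover have "insert j (\<sigma> \<inter> V1) \<union> (\<sigma> \<inter> V2) \<subseteq> V1 \<union> V2" using sub(1) that by auto
          ultimately show ?thesis unfolding W_def using sub(2) by presburger
        qed
        then have "chain_bdry V1 (\<lambda>\<rho>. W (\<rho> \<union> (\<sigma> \<inter> V2))) (\<sigma> \<inter> V1)
          = (if card (\<sigma> \<inter> V2) = k then chain_bdry V1 (w (\<sigma> \<inter> V2)) (\<sigma> \<inter> V1) else 0)"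
          unfolding chain_bdry_def by auto
        then show ?thesis using w(2)[OF sub(2), of "\<sigma> \<inter> V1"] \<sigma>_eq by auto
      qed
      finally have "c' \<sigma> = (if card (\<sigma> \<inter> V2) = k then 0 else c \<sigma>)" by (simp add: c'_def \<sigma>_eq)
      then have "card (\<sigma> \<inter> V2) \<noteq> k" "c \<sigma> \<noteq> 0" using that by (auto split: if_splits)
      then show False using Suc.prems(3)[of \<sigma>] * by simp
    qed
    ultimately obtain u where u: "u \<in> chains \<Gamma> (Suc n)" "chain_bdry (V1 \<union> V2) u = c'"
      using Suc.IH[OF c'] by blast
    have "chain_bdry (V1 \<union> V2) (u + W) = c"
      unfolding chain_bdry_add u(2) c'_def by (rule diff_add_cancel)
    then show ?thesis using chains_add[OF u(1) W] by blast
  qed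
qed

lemma acyclic_at_join_of_acyclic:
  assumes "\<And>i. acyclic_at TYPE('k::field) V1 \<Gamma>1 i"
  shows "acyclic_at TYPE('k) (V1 \<union> V2) \<Gamma> n"
  unfolding acyclic_at_def
proof (intro ballI impI)
  fix c :: "nat set \<Rightarrow> 'k" assume "c \<in> chains \<Gamma> n" "chain_bdry (V1 \<union> V2) c = 0"
  moreover have "card (\<sigma> \<inter> V2) < Suc (card V2)" for \<sigma>
    using card_mono[of V2 "\<sigma> \<inter> V2"] finite_vertices by auto
  ultimately show "\<exists>w\<in>chains \<Gamma> (Suc n). chain_bdry (V1 \<union> V2) w = c"
    using acyclic_filtered[OF assms] by blast
qed

text \<open>
  If \<open>\<Gamma>1\<close> has a vertex then it is acyclic in degree 0 too; otherwise \<open>\<Gamma>\<close> is \<open>\<Gamma>2\<close> or empty.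
\<close>

lemma acyclic_at_join:
  assumes "\<And>i. acyclic_at TYPE('k::field) V1 \<Gamma>1 (Suc i)"
    and "\<And>i. acyclic_at TYPE('k) V2 \<Gamma>2 (Suc i)"
  shows "acyclic_at TYPE('k) (V1 \<union> V2) \<Gamma> (Suc n)"
proof (cases "\<exists>v. {v} \<in> \<Gamma>1")
  case True
  then obtain v where v: "{v} \<in> \<Gamma>1" by blast
  then have vV: "v \<in> V1" using simplicial_complex_subset[OF complex1] by blast
  have "acyclic_at TYPE('k) V1 \<Gamma>1 0"
    unfolding acyclic_at_def
  proof (intro ballI impI)
    fix c :: "nat set \<Rightarrow> 'k" assume c: "c \<in> chains \<Gamma>1 0"
    have c0: "c \<sigma> = 0" if "\<sigma> \<noteq> {}" for \<sigma>
      using c that simplicial_complex_finite[OF complex1, of \<sigma>] by (auto simp: chains_def)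
    \<comment> \<open>The boundary of a vertex is the empty face with sign 1, so any single vertex
      fills a chain of degree 0.\<close>
    define w where "w \<sigma> = (if \<sigma> = {v} then c {} else 0)" for \<sigma>
    have "chain_bdry V1 w \<tau> = c \<tau>" for \<tau>
    proof (cases "\<tau> = {}")
      case True
      have "chain_bdry V1 w \<tau> = (\<Sum>j\<in>V1. if j = v then c {} else 0)"
        unfolding chain_bdry_def True by (intro sum.cong) (auto simp: w_def)
      then show ?thesis using True vV finite_vertices by simp
    next
      case False
      have "w (insert j \<tau>) = 0" if "j \<in> V1 - \<tau>" for j using that False by (auto simp: w_def)
      then have "chain_bdry V1 w \<tau> = 0" by (simp add: chain_bdry_def)
      then show ?thesis using c0[OF False] by simp
    qed
    moreover have "w \<in> chains \<Gamma>1 (Suc 0)" using v by (auto simp: chains_def w_def)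
    ultimately show "\<exists>w\<in>chains \<Gamma>1 (Suc 0). chain_bdry V1 w = c" by blast
  qed
  then have "acyclic_at TYPE('k) V1 \<Gamma>1 i" for i using assms(1) by (cases i) auto
  then show ?thesis by (rule acyclic_at_join_of_acyclic)
next
  case False
  then have \<Gamma>1: "\<sigma> = {}" if "\<sigma> \<in> \<Gamma>1" for \<sigma>
    using that simplicial_complex_downD[OF complex1 that] by blast
  have sub: "\<Gamma> \<subseteq> \<Gamma>2"
  proof
    fix \<sigma> assume "\<sigma> \<in> \<Gamma>"
    then have "\<sigma> \<subseteq> V1 \<union> V2" "\<sigma> \<inter> V1 = {}" "\<sigma> \<inter> V2 \<in> \<Gamma>2" using \<Gamma>1 by (auto simp: face_iff)
    moreover then have "\<sigma> \<inter> V2 = \<sigma>" by auto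
    ultimately show "\<sigma> \<in> \<Gamma>2" by simp
  qed
  \<comment> \<open>A face of \<open>\<Gamma>\<close> is what guarantees that the empty face lies in
    \<open>\<Gamma>1\<close>, that is, that \<open>\<Gamma>1\<close> is not empty.\<close>
  have sup: "\<Gamma>2 \<subseteq> \<Gamma>" if "\<Gamma> \<noteq> {}"
  proof
    fix \<sigma> assume "\<sigma> \<in> \<Gamma>2"
    moreover then have "\<sigma> \<subseteq> V2" by (rule simplicial_complex_subset[OF complex2])
    moreover then have "\<sigma> \<inter> V2 = \<sigma>" "\<sigma> \<inter> V1 = {}" using disjoint by auto
    moreover obtain \<rho> where "\<rho> \<in> \<Gamma>" using \<open>\<Gamma> \<noteq> {}\<close> by blast
    then have "\<rho> \<inter> V1 \<in> \<Gamma>1" by (simp add: face_iff)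
    then have "{} \<in> \<Gamma>1" using \<Gamma>1[of "\<rho> \<inter> V1"] by simp
    ultimately show "\<sigma> \<in> \<Gamma>" by (auto simp: face_iff)
  qed
  have eq: "chain_bdry (V1 \<union> V2) c = chain_bdry V2 c" if "c \<in> chains \<Gamma>2 i" for c :: "nat set \<Rightarrow> 'k" and i
    by (rule chain_bdry_vertices_cong[OF that])
       (use finite_vertices simplicial_complex_subset[OF complex2] in auto)
  show ?thesis
  proof (cases "\<Gamma> = {}")
    case True
    have "c = 0" if "c \<in> chains \<Gamma> (Suc n)" for c :: "nat set \<Rightarrow> 'k"
      using that True by (auto simp: chains_def)
    then show ?thesis unfolding acyclic_at_def by (metis chain_bdry_zero zero_in_chains)
  next
    case False
    then have "\<Gamma> = \<Gamma>2" using sub sup by blast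
    then show ?thesis using assms(2)[of n] eq unfolding acyclic_at_def by metis
  qed
qed

end

section \<open>Homogenizations by multidegree\<close>

interpretation ideal: module "(*) :: 'a::comm_ring_1 \<Rightarrow> 'a \<Rightarrow> 'a"
  by standard (auto simp: algebra_simps)

lemma exponent_add_diff: "c \<le> d \<Longrightarrow> c + (d - c) = (d :: 'n \<Rightarrow> nat)"
  by (auto simp: fun_eq_iff le_fun_def)

lemma lookup_mon_mult:
  "Poly_Mapping.lookup (mon c * p) d = (if c \<le> d then Poly_Mapping.lookup p (d - c) else 0)"
proof -
  have "Poly_Mapping.lookup (mon c * p) d = (\<Sum>l. (\<Sum>q. Poly_Mapping.lookup p q when d = l + q) when c = l)"
    unfolding lookup_mult mon_def lookup_single by (simp add: when_mult)
  also have "\<dots> = (\<Sum>q. Poly_Mapping.lookup p q when d = c + q)"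
    by simp
  also have "\<dots> = (if c \<le> d then Poly_Mapping.lookup p (d - c) else 0)"
  proof (cases "c \<le> d")
    case True
    have "d = c + q \<longleftrightarrow> q = d - c" for q
      using exponent_add_diff[OF True] by (metis add_left_cancel)
    then show ?thesis using True by simp
  next
    case False
    then have "d \<noteq> c + q" for q by (auto simp: le_fun_def)
    then show ?thesis using False by simp
  qed
  finally show ?thesis .
qed

lemma lookup_minus_one_power_mult:
  "Poly_Mapping.lookup ((-1) ^ k * p) d = (-1) ^ k * (Poly_Mapping.lookup p d :: 'k::comm_ring_1)"
  by (cases "even k") auto

lemma mon_mult: "mon a * mon b = mon (a + b)"
  by (simp add: mon_def mult_single)

lemma sum_fun_apply: "(\<Sum>i\<in>A. f i) x = (\<Sum>i\<in>A. f i x)"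
  by (induction A rule: infinite_finite_induct) auto

text \<open>In a face with at least two vertices each vertex survives the removal of another one, so
  the recursive lcm sees all labels. This universal property replaces the recursion from here
  on.\<close>

lemma face_deg_le_iff:
  assumes "finite \<sigma>"
  shows "face_deg m \<sigma> \<le> a \<longleftrightarrow> (\<forall>j\<in>\<sigma>. m j \<le> a)"
  using assms
proof (induction "card \<sigma>" arbitrary: \<sigma> rule: less_induct)
  case less
  consider "card \<sigma> = 0" | "card \<sigma> = 1" | "card \<sigma> \<ge> 2" by linarith
  then show ?case
  proof cases
    case 1
    then show ?thesis using less.prems by (simp add: face_deg.simps le_fun_def)
  next
    case 2
    then obtain j where "\<sigma> = {j}" by (auto simp: card_1_singleton_iff)
    then show ?thesis by (simp add: face_deg.simps)
  next
    case 3
    then have ne: "\<sigma> \<noteq> {}" by auto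
    have "face_deg m \<sigma> = Sup_fin ((\<lambda>j. face_deg m (\<sigma> - {j})) ` \<sigma>)"
      using 3 by (subst face_deg.simps) auto
    then have "face_deg m \<sigma> \<le> a \<longleftrightarrow> (\<forall>j\<in>\<sigma>. face_deg m (\<sigma> - {j}) \<le> a)"
      using less.prems ne by (simp add: Sup_fin.bounded_iff)
    also have "\<dots> \<longleftrightarrow> (\<forall>j\<in>\<sigma>. \<forall>k\<in>\<sigma> - {j}. m k \<le> a)"
      using less.hyps[OF card_Diff1_less] less.prems by (intro ball_cong refl) auto
    also have "\<dots> \<longleftrightarrow> (\<forall>k\<in>\<sigma>. m k \<le> a)"
    proof -
      have "\<exists>j\<in>\<sigma>. k \<in> \<sigma> - {j}" if k: "k \<in> \<sigma>" for k
      proof -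
        have "\<not> \<sigma> \<subseteq> {k}" using 3 card_mono[of "{k}" \<sigma>] by auto
        then show ?thesis using k by auto
      qed
      then show ?thesis by blast
    qed
    finally show ?thesis .
  qed
qed

lemma face_deg_mono:
  assumes "finite \<tau>" "\<sigma> \<subseteq> \<tau>" shows "face_deg m \<sigma> \<le> face_deg m \<tau>"
  using face_deg_le_iff[OF assms(1), of m "face_deg m \<tau>"]
    face_deg_le_iff[OF finite_subset[OF assms(2,1)], of m "face_deg m \<tau>"] assms(2) by blast

lemma face_deg_apply_le_iff:
  assumes "finite \<sigma>"
  shows "face_deg m \<sigma> x \<le> t \<longleftrightarrow> (\<forall>j\<in>\<sigma>. m j x \<le> t)"
proof -
  \<comment> \<open>All coordinates except \<open>x\<close> are left at their values in
    \<open>face_deg m \<sigma>\<close>, so that the comparison of vectors only tests coordinate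
    \<open>x\<close>.\<close>
  let ?a = "(face_deg m \<sigma>)(x := t)"
  have "face_deg m \<sigma> x \<le> t \<longleftrightarrow> face_deg m \<sigma> \<le> ?a"
    by (auto simp: le_fun_def)
  also have "\<dots> \<longleftrightarrow> (\<forall>j\<in>\<sigma>. m j \<le> ?a)"
    by (rule face_deg_le_iff[OF assms])
  also have "\<dots> \<longleftrightarrow> (\<forall>j\<in>\<sigma>. m j x \<le> t)"
  proof -
    have "m j \<le> face_deg m \<sigma>" if "j \<in> \<sigma>" for j
      using face_deg_le_iff[OF assms, of m "face_deg m \<sigma>"] that by blast
    then show ?thesis by (force simp: le_fun_def)
  qed
  finally show ?thesis .
qed

section \<open>Coefficients of the homogenized boundary\<close>

lemma homogenization_sel [simp]:
  "basis (homogenization m \<Delta>) i = {\<sigma> \<in> \<Delta>. card \<sigma> = i}"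
  "mdeg (homogenization m \<Delta>) i = face_deg m"
  by (simp_all add: homogenization_def)

lemma face_sign_insert: "face_sign j (insert j \<tau>) = (face_sign j \<tau> :: ('n, 'k::field) mpoly)"
proof -
  have "{i \<in> insert j \<tau>. i < j} = {i \<in> \<tau>. i < j}" by auto
  then show ?thesis by (simp add: face_sign_def)
qed

text \<open>The pairs of a face \<sigma> and a vertex \<open>j\<close> with
  \<open>\<sigma> - {j} = \<tau>\<close> are determined by \<open>j\<close>, as
  \<open>\<sigma> = insert j \<tau>\<close>. Collecting them gives the same shape as
  \<open>chain_bdry\<close>.\<close>

lemma homogenization_bdry_apply:
  fixes x :: "nat set \<Rightarrow> ('n::finite, 'k::field) mpoly"
  assumes "simplicial_complex V \<Delta>" "x \<in> free_mod {\<sigma> \<in> \<Delta>. card \<sigma> = i}"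
  shows "bdry (homogenization m \<Delta>) i x \<tau> =
    (\<Sum>j\<in>V - \<tau>. x (insert j \<tau>) * (face_sign j \<tau> * mon (face_deg m (insert j \<tau>) - face_deg m \<tau>)))"
proof -
  let ?F = "{\<sigma> \<in> \<Delta>. card \<sigma> = i}"
  let ?g = "\<lambda>\<sigma> j. x \<sigma> * (face_sign j \<sigma> * mon (face_deg m \<sigma> - face_deg m (\<sigma> - {j})))"
  have V: "finite V" using assms(1) by (simp add: simplicial_complex_def)
  have fin: "finite ?F" "\<And>\<sigma>. \<sigma> \<in> ?F \<Longrightarrow> finite \<sigma>"
    using simplicial_complex_finite_faces[OF assms(1)] simplicial_complex_finite[OF assms(1)] by auto
  have "bdry (homogenization m \<Delta>) i x \<tau> = (\<Sum>\<sigma>\<in>?F. \<Sum>j\<in>\<sigma>. if \<tau> = \<sigma> - {j} then ?g \<sigma> j else 0)"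
    unfolding homogenization_def
    by (simp add: sum_fun_apply smult_def face_bdry_def unit_vec_def sum_distrib_left if_distrib cong: if_cong)
  also have "\<dots> = (\<Sum>(\<sigma>, j)\<in>Sigma ?F (\<lambda>\<sigma>. \<sigma>). if \<tau> = \<sigma> - {j} then ?g \<sigma> j else 0)"
    by (rule sum.Sigma[OF fin(1)]) (intro ballI fin(2))
  also have "\<dots> = (\<Sum>(\<sigma>, j)\<in>{(\<sigma>, j). \<sigma> \<in> ?F \<and> j \<in> \<sigma> \<and> \<tau> = \<sigma> - {j}}. ?g \<sigma> j)"
  proof (rule sum.mono_neutral_cong_right)
    show "finite (Sigma ?F (\<lambda>\<sigma>. \<sigma>))" by (intro finite_SigmaI fin)
  qed (auto split: if_splits)
  also have "\<dots> = (\<Sum>j\<in>{j \<in> V - \<tau>. insert j \<tau> \<in> ?F}.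
      x (insert j \<tau>) * (face_sign j \<tau> * mon (face_deg m (insert j \<tau>) - face_deg m \<tau>)))"
  proof (rule sum.reindex_bij_witness[of _ "\<lambda>j. (insert j \<tau>, j)" snd])
    fix p assume p: "p \<in> {(\<sigma>, j). \<sigma> \<in> ?F \<and> j \<in> \<sigma> \<and> \<tau> = \<sigma> - {j}}"
    then obtain \<sigma> j where \<sigma>: "p = (\<sigma>, j)" "\<sigma> \<in> ?F" "j \<in> \<sigma>" "\<tau> = \<sigma> - {j}" by blast
    then have ins: "insert j \<tau> = \<sigma>" by auto
    then show "(insert (snd p) \<tau>, snd p) = p" using \<sigma> by simp
    have "\<sigma> \<subseteq> V" using \<sigma>(2) simplicial_complex_subset[OF assms(1)] by auto
    then show "snd p \<in> {j \<in> V - \<tau>. insert j \<tau> \<in> ?F}" using \<sigma> ins by auto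
    show "x (insert (snd p) \<tau>) * (face_sign (snd p) \<tau> * mon (face_deg m (insert (snd p) \<tau>) - face_deg m \<tau>))
       = (case p of (\<sigma>, j) \<Rightarrow> ?g \<sigma> j)"
      using face_sign_insert[of j \<tau>, where ?'n='n and ?'k='k] unfolding \<sigma>(1) snd_conv split ins \<sigma>(4)[symmetric] by simp
  qed auto
  also have "\<dots> = (\<Sum>j\<in>V - \<tau>. x (insert j \<tau>) * (face_sign j \<tau> * mon (face_deg m (insert j \<tau>) - face_deg m \<tau>)))"
    by (rule sum.mono_neutral_left) (use assms(2) V in \<open>auto simp: free_mod_def\<close>)
  finally show ?thesis .
qed

text \<open>
  \<open>strand m a x\<close> is the component of \<open>x\<close> of multidegree \<open>a\<close>, read as a chain over the field via
  \<open>(x\<^sup>a / m\<^sub>\<sigma>) e\<^sub>\<sigma> \<mapsto> e\<^sub>\<sigma>\<close>; \<open>lift_strand\<close> goes back.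
\<close>

definition strand :: "(nat \<Rightarrow> 'n \<Rightarrow> nat) \<Rightarrow> ('n \<Rightarrow> nat) \<Rightarrow> (nat set \<Rightarrow> ('n, 'k::field) mpoly) \<Rightarrow> nat set \<Rightarrow> 'k" where
  "strand m a x \<sigma> = (if face_deg m \<sigma> \<le> a then Poly_Mapping.lookup (x \<sigma>) (a - face_deg m \<sigma>) else 0)"

definition lift_strand :: "(nat \<Rightarrow> 'n \<Rightarrow> nat) \<Rightarrow> ('n \<Rightarrow> nat) \<Rightarrow> (nat set \<Rightarrow> 'k) \<Rightarrow> nat set \<Rightarrow> ('n, 'k::field) mpoly" where
  "lift_strand m a c \<sigma> = (if face_deg m \<sigma> \<le> a then Poly_Mapping.single (a - face_deg m \<sigma>) (c \<sigma>) else 0)"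

definition faces_below :: "(nat \<Rightarrow> 'n \<Rightarrow> nat) \<Rightarrow> nat set set \<Rightarrow> ('n \<Rightarrow> nat) \<Rightarrow> nat set set" where
  "faces_below m \<Delta> a = {\<sigma> \<in> \<Delta>. face_deg m \<sigma> \<le> a}"

section \<open>Decomposition into strands\<close>

lemma strand_zero [simp]: "strand m a 0 = 0"
  by (rule ext) (simp add: strand_def)

lemma strand_sum: "strand m a (\<Sum>i\<in>A. x i) = (\<Sum>i\<in>A. strand m a (x i))"
  by (rule ext) (simp add: strand_def sum_fun_apply lookup_sum)

lemma strand_self: "strand m (c + face_deg m \<sigma>) x \<sigma> = Poly_Mapping.lookup (x \<sigma>) c"
  by (simp add: strand_def le_fun_def)

text \<open>The monomial with exponent \<open>c\<close> at \<sigma> has multidegree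
  \<open>c + face_deg m \<sigma>\<close>, so every coefficient shows up in some strand.\<close>

lemma strand_eqI:
  assumes "\<And>a. strand m a x = strand m a y" shows "x = y"
  by (intro ext poly_mapping_eqI) (metis assms strand_self)

lemma strand_in_chains:
  "x \<in> free_mod {\<sigma> \<in> \<Delta>. card \<sigma> = i} \<Longrightarrow> strand m a x \<in> chains (faces_below m \<Delta> a) i"
  by (auto simp: chains_def strand_def faces_below_def free_mod_def split: if_splits)

lemma lift_strand_in_free_mod:
  "c \<in> chains \<Delta> i \<Longrightarrow> lift_strand m a c \<in> free_mod {\<sigma> \<in> \<Delta>. card \<sigma> = i}"
  unfolding chains_def lift_strand_def free_mod_def by (auto simp: single_zero) (metis single_zero)+

lemma strand_lift_strand:
  assumes "c \<in> chains (faces_below m \<Delta> a) i"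
  shows "strand m b (lift_strand m a c) = (if a = b then c else 0)"
proof
  fix \<sigma>
  have c: "c \<sigma> \<noteq> 0 \<Longrightarrow> face_deg m \<sigma> \<le> a" using assms by (auto simp: chains_def faces_below_def)
  have "a = b" if "face_deg m \<sigma> \<le> a" "face_deg m \<sigma> \<le> b" "a - face_deg m \<sigma> = b - face_deg m \<sigma>"
    using that by (metis exponent_add_diff)
  then show "strand m b (lift_strand m a c) \<sigma> = (if a = b then c else 0) \<sigma>"
    using c by (auto simp: strand_def lift_strand_def lookup_single when_def)
qed

text \<open>Multiplying by the quotient of the two face monomials turns the cofactor of the larger
  face in \<open>x^a\<close> into that of the smaller one, so only the sign is left. If the larger
  face is not below \<open>a\<close>, both sides have no such term.\<close>

lemma strand_bdry:
  assumes "simplicial_complex V \<Delta>" "x \<in> free_mod {\<sigma> \<in> \<Delta>. card \<sigma> = i}"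
  shows "strand m a (bdry (homogenization m \<Delta>) i x) = chain_bdry V (strand m a x)"
proof
  fix \<tau>
  have term_eq: "(if face_deg m \<tau> \<le> a then Poly_Mapping.lookup
        (x (insert j \<tau>) * (face_sign j \<tau> * mon (face_deg m (insert j \<tau>) - face_deg m \<tau>))) (a - face_deg m \<tau>) else 0)
      = (-1) ^ card {i \<in> \<tau>. i < j} * strand m a x (insert j \<tau>)" (is "?L = ?R") for j
  proof (cases "insert j \<tau> \<in> \<Delta>")
    case False
    then show ?thesis using assms(2) by (simp add: free_mod_def strand_def)
  next
    case True
    then have le: "face_deg m \<tau> \<le> face_deg m (insert j \<tau>)"
      by (intro face_deg_mono) (use simplicial_complex_finite[OF assms(1) True] in auto)
    have comm: "x (insert j \<tau>) * (face_sign j \<tau> * mon c) = (-1) ^ card {i \<in> \<tau>. i < j} * (mon c * x (insert j \<tau>))" for c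
      unfolding face_sign_def by (rule trans[OF mult.commute mult.assoc])
    show ?thesis
    proof (cases "face_deg m \<tau> \<le> a")
      case False
      then show ?thesis using le by (auto simp: strand_def dest: order_trans)
    next
      case True
      have "face_deg m (insert j \<tau>) - face_deg m \<tau> \<le> a - face_deg m \<tau> \<longleftrightarrow> face_deg m (insert j \<tau>) \<le> a"
        using True le by (simp add: le_fun_def le_diff_iff)
      moreover have "a - face_deg m \<tau> - (face_deg m (insert j \<tau>) - face_deg m \<tau>) = a - face_deg m (insert j \<tau>)"
        using True le by (auto simp: le_fun_def fun_eq_iff)
      ultimately show ?thesis
        unfolding comm lookup_minus_one_power_mult lookup_mon_mult using True by (simp add: strand_def)
    qed
  qed
  have "strand m a (bdry (homogenization m \<Delta>) i x) \<tau> = (\<Sum>j\<in>V - \<tau>. if face_deg m \<tau> \<le> a then Poly_Mapping.lookup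
        (x (insert j \<tau>) * (face_sign j \<tau> * mon (face_deg m (insert j \<tau>) - face_deg m \<tau>))) (a - face_deg m \<tau>) else 0)"
    unfolding strand_def homogenization_bdry_apply[OF assms] by (simp add: lookup_sum)
  then show "strand m a (bdry (homogenization m \<Delta>) i x) \<tau> = chain_bdry V (strand m a x) \<tau>"
    unfolding term_eq chain_bdry_def .
qed

text \<open>Expresses homogeneity by strands, so that \<open>strand_bdry\<close> yields that the
  boundary preserves multidegrees.\<close>

lemma graded_part_iff:
  "x \<in> graded_part B (face_deg m) a \<longleftrightarrow> x \<in> free_mod B \<and> (\<forall>b. b \<noteq> a \<longrightarrow> strand m b x = 0)"
proof (intro iffI conjI allI impI)
  fix b assume x: "x \<in> graded_part B (face_deg m) a" and ba: "b \<noteq> a"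
  show "strand m b x = 0"
  proof
    fix \<sigma>
    show "strand m b x \<sigma> = 0 \<sigma>"
    proof (rule ccontr)
      assume "strand m b x \<sigma> \<noteq> 0 \<sigma>"
      then have *: "face_deg m \<sigma> \<le> b" "b - face_deg m \<sigma> \<in> Poly_Mapping.keys (x \<sigma>)"
        by (auto simp: strand_def in_keys_iff split: if_splits)
      then have "\<sigma> \<in> B" using x by (auto simp: graded_part_def free_mod_def)
      then have "b - face_deg m \<sigma> + face_deg m \<sigma> = a" using x * by (auto simp: graded_part_def)
      then show False using ba exponent_add_diff[OF *(1)] by (simp add: add.commute)
    qed
  qed
next
  assume "x \<in> graded_part B (face_deg m) a" then show "x \<in> free_mod B" by (simp add: graded_part_def)
next
  assume x: "x \<in> free_mod B \<and> (\<forall>b. b \<noteq> a \<longrightarrow> strand m b x = 0)"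
  have "c + face_deg m \<sigma> = a" if "c \<in> Poly_Mapping.keys (x \<sigma>)" for c \<sigma>
  proof (rule ccontr)
    assume "c + face_deg m \<sigma> \<noteq> a"
    then have "strand m (c + face_deg m \<sigma>) x \<sigma> = 0" using x by simp
    then show False using that by (simp add: strand_self in_keys_iff)
  qed
  then show "x \<in> graded_part B (face_deg m) a" using x by (simp add: graded_part_def)
qed

lemma homogenization_multigraded_complex:
  assumes "simplicial_complex V \<Delta>"
  shows "multigraded_complex (homogenization m \<Delta> :: (nat set, 'n::finite, 'k::field) mg_complex)"
  (is "multigraded_complex ?H")
proof -
  have V: "finite V" using assms by (simp add: simplicial_complex_def)
  have fm: "bdry ?H (Suc i) x \<in> free_mod {\<sigma> \<in> \<Delta>. card \<sigma> = i}"
    if x: "x \<in> free_mod {\<sigma> \<in> \<Delta>. card \<sigma> = Suc i}" for i and x :: "nat set \<Rightarrow> ('n, 'k) mpoly"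
    unfolding free_mod_def mem_Collect_eq
  proof (intro allI impI)
    fix \<tau> assume \<tau>: "\<not> (\<tau> \<in> \<Delta> \<and> card \<tau> = i)"
    have "x (insert j \<tau>) = 0" if "j \<in> V - \<tau>" for j
    proof (rule ccontr)
      assume "x (insert j \<tau>) \<noteq> 0"
      then have *: "insert j \<tau> \<in> \<Delta>" "card (insert j \<tau>) = Suc i" using x by (auto simp: free_mod_def)
      then have "\<tau> \<in> \<Delta>" "finite (insert j \<tau>)"
        using simplicial_complex_downD[OF assms *(1)] simplicial_complex_finite[OF assms *(1)] by auto
      then show False using * \<tau> that by auto
    qed
    then show "bdry ?H (Suc i) x \<tau> = 0" by (simp add: homogenization_bdry_apply[OF assms x])
  qed
  have "multigraded_hom {\<sigma> \<in> \<Delta>. card \<sigma> = Suc i} (face_deg m) {\<sigma> \<in> \<Delta>. card \<sigma> = i} (face_deg m) (bdry ?H (Suc i))" for i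
    unfolding multigraded_hom_def
  proof (intro conjI ballI allI)
    fix x :: "nat set \<Rightarrow> ('n, 'k) mpoly" assume "x \<in> free_mod {\<sigma> \<in> \<Delta>. card \<sigma> = Suc i}"
    then show "bdry ?H (Suc i) x \<in> free_mod {\<sigma> \<in> \<Delta>. card \<sigma> = i}" by (rule fm)
  next
    fix x y :: "nat set \<Rightarrow> ('n, 'k) mpoly"
    show "bdry ?H (Suc i) (x + y) = bdry ?H (Suc i) x + bdry ?H (Suc i) y"
      by (rule ext) (simp add: homogenization_def smult_def sum_fun_apply algebra_simps sum.distrib)
  next
    fix p and x :: "nat set \<Rightarrow> ('n, 'k) mpoly"
    show "bdry ?H (Suc i) (smult p x) = smult p (bdry ?H (Suc i) x)"
      unfolding homogenization_def mg_complex.simps smult_def mult.assoc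
      by (rule ext) (simp only: sum_fun_apply sum_distrib_left)
  next
    fix a and x :: "nat set \<Rightarrow> ('n, 'k) mpoly" assume x: "x \<in> graded_part {\<sigma> \<in> \<Delta>. card \<sigma> = Suc i} (face_deg m) a"
    then have x': "x \<in> free_mod {\<sigma> \<in> \<Delta>. card \<sigma> = Suc i}" by (simp add: graded_part_def)
    show "bdry ?H (Suc i) x \<in> graded_part {\<sigma> \<in> \<Delta>. card \<sigma> = i} (face_deg m) a"
      using x fm[OF x'] unfolding graded_part_iff by (simp add: strand_bdry[OF assms x'])
  qed
  moreover have "bdry ?H (Suc i) (bdry ?H (Suc (Suc i)) x) = 0"
    if x: "x \<in> free_mod {\<sigma> \<in> \<Delta>. card \<sigma> = Suc (Suc i)}" for i and x :: "nat set \<Rightarrow> ('n, 'k) mpoly"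
    by (rule strand_eqI[of m])
       (simp only: strand_bdry[OF assms fm[OF x]] strand_bdry[OF assms x] chain_bdry_chain_bdry[OF V] strand_zero)
  ultimately show ?thesis
    using simplicial_complex_finite_faces[OF assms] by (simp add: multigraded_complex_def)
qed

text \<open>The complex is the direct sum of its strands and an element meets finitely many of them,
  so bounding chains found in each multidegree can be lifted and added. The inclusion left out is
  the vanishing of the squared boundary.\<close>

lemma homogenization_exact_iff:
  assumes "simplicial_complex V \<Delta>"
  shows "{x \<in> free_mod {\<sigma> \<in> \<Delta>. card \<sigma> = Suc i}. bdry (homogenization m \<Delta>) (Suc i) x = 0}
      \<subseteq> bdry (homogenization m \<Delta> :: (nat set, 'n::finite, 'k::field) mg_complex) (Suc (Suc i))
          ` free_mod {\<sigma> \<in> \<Delta>. card \<sigma> = Suc (Suc i)}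
    \<longleftrightarrow> (\<forall>a. acyclic_at TYPE('k) V (faces_below m \<Delta> a) (Suc i))" (is "?exact \<longleftrightarrow> ?acyclic")
proof
  let ?H = "homogenization m \<Delta> :: (nat set, 'n, 'k) mg_complex"
  let ?F = "\<lambda>i. free_mod {\<sigma> \<in> \<Delta>. card \<sigma> = i} :: (nat set \<Rightarrow> ('n, 'k) mpoly) set"
  have below: "faces_below m \<Delta> a \<subseteq> \<Delta>" for a by (auto simp: faces_below_def)
  have lift: "lift_strand m a c \<in> ?F n" if "c \<in> chains (faces_below m \<Delta> a) n" for a c n
    using that chains_mono[OF below] by (blast intro: lift_strand_in_free_mod)
  {
    assume exact: ?exact
    show ?acyclic
      unfolding acyclic_at_def
    proof (intro allI ballI impI)
      fix a and c :: "nat set \<Rightarrow> 'k"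
      assume c: "c \<in> chains (faces_below m \<Delta> a) (Suc i)" and cyc: "chain_bdry V c = 0"
      have "bdry ?H (Suc i) (lift_strand m a c) = 0"
        by (rule strand_eqI[of m]) (simp add: strand_bdry[OF assms lift[OF c]] strand_lift_strand[OF c] cyc)
      then have "lift_strand m a c \<in> bdry ?H (Suc (Suc i)) ` ?F (Suc (Suc i))"
        using exact lift[OF c] by (auto dest: subsetD)
      then obtain y where y: "lift_strand m a c = bdry ?H (Suc (Suc i)) y" "y \<in> ?F (Suc (Suc i))"
        by (rule imageE)
      have "chain_bdry V (strand m a y) = c"
        using strand_bdry[OF assms y(2), of m a] strand_lift_strand[OF c, of a] unfolding y(1)[symmetric] by simp
      then show "\<exists>w\<in>chains (faces_below m \<Delta> a) (Suc (Suc i)). chain_bdry V w = c"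
        using strand_in_chains[OF y(2)] by blast
    qed
  next
    assume acyclic: ?acyclic
    show ?exact
    proof (rule subsetI, elim CollectE conjE)
      fix x assume x: "x \<in> ?F (Suc i)" and cyc: "bdry ?H (Suc i) x = 0"
      have "\<exists>w\<in>chains (faces_below m \<Delta> a) (Suc (Suc i)). chain_bdry V w = strand m a x" for a
      proof -
        have "chain_bdry V (strand m a x) = 0"
          using strand_bdry[OF assms x, of m a] cyc by simp
        then show ?thesis using acyclic strand_in_chains[OF x, of m a] unfolding acyclic_at_def by blast
      qed
      then obtain w where w: "w a \<in> chains (faces_below m \<Delta> a) (Suc (Suc i))" "chain_bdry V (w a) = strand m a x" for a
        by metis
      \<comment> \<open>The multidegrees occurring in \<open>x\<close>. Restricting the choices
        \<open>w a\<close> to them makes the sum of the lifts finite.\<close>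
      define A where "A = (\<Union>\<sigma>\<in>\<Delta>. (\<lambda>c. c + face_deg m \<sigma>) ` Poly_Mapping.keys (x \<sigma>))"
      have "finite A" unfolding A_def using simplicial_complex_finite_faces[OF assms] by auto
      have outside: "strand m a x = 0" if "a \<notin> A" for a
      proof
        fix \<sigma>
        show "strand m a x \<sigma> = 0 \<sigma>"
        proof (rule ccontr)
          assume "strand m a x \<sigma> \<noteq> 0 \<sigma>"
          then have *: "face_deg m \<sigma> \<le> a" "a - face_deg m \<sigma> \<in> Poly_Mapping.keys (x \<sigma>)"
            by (auto simp: strand_def in_keys_iff split: if_splits)
          then have "\<sigma> \<in> \<Delta>" using x by (auto simp: free_mod_def)
          moreover have "a = a - face_deg m \<sigma> + face_deg m \<sigma>"
            using exponent_add_diff[OF *(1)] by (simp add: add.commute)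
          ultimately have "a \<in> A" using * unfolding A_def by blast
          then show False using that by simp
        qed
      qed
      define y where "y = (\<Sum>a\<in>A. lift_strand m a (w a))"
      have y: "y \<in> ?F (Suc (Suc i))"
        using lift[OF w(1)] by (auto simp: y_def free_mod_def sum_fun_apply)
      have "bdry ?H (Suc (Suc i)) y = x"
      proof (rule strand_eqI[of m])
        fix b
        have "strand m b y = (\<Sum>a\<in>A. if a = b then w a else 0)"
          by (simp add: y_def strand_sum strand_lift_strand[OF w(1)])
        also have "\<dots> = (if b \<in> A then w b else 0)"
          using \<open>finite A\<close> by simp
        finally show "strand m b (bdry ?H (Suc (Suc i)) y) = strand m b x"
          using w(2)[of b] outside[of b] by (simp add: strand_bdry[OF assms y])
      qed
      then show "x \<in> bdry ?H (Suc (Suc i)) ` ?F (Suc (Suc i))" using y by blast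
    qed
  }
qed

section \<open>Monomial ideals\<close>

lemma mon_eq_iff [simp]: "(mon a :: ('n, 'k::field) mpoly) = mon b \<longleftrightarrow> a = b"
  unfolding mon_def by (metis keys_single singleton_inject zero_neq_one)

lemma mon_in_ideal_gen:
  assumes "b \<in> S" "b \<le> c" shows "(mon c :: ('n, 'k::field) mpoly) \<in> ideal_gen (mon ` S)"
proof -
  have "(mon c :: ('n, 'k) mpoly) = mon (c - b) * mon b"
    using exponent_add_diff[OF assms(2)] by (simp add: mon_mult add.commute)
  also have "\<dots> \<in> ideal_gen (mon ` S)"
    using assms(1) by (intro ideal.span_scale ideal.span_base imageI)
  finally show ?thesis .
qed

lemma keys_ideal_gen_mon:
  assumes "(p :: ('n, 'k::field) mpoly) \<in> ideal_gen (mon ` S)" "c \<in> Poly_Mapping.keys p"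
  shows "\<exists>b\<in>S. b \<le> c"
  using assms
proof (induction p rule: ideal.span_induct_alt)
  case (step q x y)
  obtain b where b: "b \<in> S" "x = mon b" using step by auto
  from step have "Poly_Mapping.lookup (mon b * q) c \<noteq> 0 \<or> c \<in> Poly_Mapping.keys y"
    by (auto simp: in_keys_iff lookup_add b(2) mult.commute)
  then show ?case
    using step b(1) by (auto simp: lookup_mon_mult split: if_splits)
qed simp

lemma mon_in_ideal_gen_iff:
  "(mon c :: ('n, 'k::field) mpoly) \<in> ideal_gen (mon ` S) \<longleftrightarrow> (\<exists>b\<in>S. b \<le> c)"
  using keys_ideal_gen_mon[of "mon c :: ('n, 'k) mpoly" S c] mon_in_ideal_gen
  by (auto simp: mon_def)

lemma lookup_zero_of_irrelevant:
  assumes "(p :: ('n, 'k::field) mpoly) \<in> ideal_gen (range var)"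
  shows "Poly_Mapping.lookup p 0 = 0"
  using assms
proof (induction p rule: ideal.span_induct_alt)
  case (step q x y)
  then obtain i where "x = var i" by auto
  moreover have "\<not> (\<lambda>j. if j = i then 1 else 0 :: nat) \<le> 0" by (auto simp: le_fun_def)
  ultimately have "Poly_Mapping.lookup (x * q) 0 = 0" unfolding var_def by (simp only: lookup_mon_mult if_False)
  then show ?case using step.IH unfolding lookup_add mult.commute[of q x] by (simp only: add_0_left)
qed simp

lemma mon_irrelevant:
  assumes "c \<noteq> 0" shows "(mon c :: ('n, 'k::field) mpoly) \<in> ideal_gen (range var)"
proof -
  obtain i where i: "c i \<noteq> 0" using assms by (auto simp: fun_eq_iff)
  let ?e = "\<lambda>j. if j = i then 1 else 0 :: nat"
  have "range (var :: 'n \<Rightarrow> ('n, 'k) mpoly) = mon ` range (\<lambda>i j. if j = i then 1 else 0)"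
    by (auto simp: var_def image_image)
  moreover have "?e \<le> c" using i by (auto simp: le_fun_def)
  ultimately show ?thesis using mon_in_ideal_gen[of ?e "range (\<lambda>i j. if j = i then 1 else 0)" c] by auto
qed

text \<open>A generator divisible by another one could be dropped without changing the
  ideal.\<close>

lemma minimal_monomial_gens_antichain:
  assumes "minimal_monomial_gens (M :: ('n::finite, 'k::field) mpoly set) A" "a \<in> A" "b \<in> A" "b \<le> a"
  shows "a = b"
proof (rule ccontr)
  assume "a \<noteq> b"
  then have b: "b \<in> A - {a}" using assms by auto
  have "mon c \<in> ideal_gen (mon ` (A - {a}) :: ('n, 'k) mpoly set)" if "c \<in> A" for c
    using that b assms(4) mon_in_ideal_gen[of c "A - {a}" c] mon_in_ideal_gen[OF b assms(4)]
    by (cases "c = a") auto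
  then have "ideal_gen (mon ` A :: ('n, 'k) mpoly set) \<subseteq> ideal_gen (mon ` (A - {a}))"
    by (intro ideal.span_minimal ideal.subspace_span) auto
  moreover have "ideal_gen (mon ` (A - {a})) \<subseteq> ideal_gen (mon ` A :: ('n, 'k) mpoly set)"
    by (intro ideal.span_mono) auto
  ultimately have "ideal_gen (mon ` (A - {a})) = M"
    using assms(1) by (auto simp: minimal_monomial_gens_def)
  then show False using assms(1,2) unfolding minimal_monomial_gens_def by blast
qed

text \<open>If \<open>a\<close> were dropped, the monomial of \<open>a\<close> could only stay in
  the ideal by being divisible by a remaining generator.\<close>

lemma minimal_monomial_gensI:
  assumes "ideal_gen (mon ` A) = (M :: ('n::finite, 'k::field) mpoly set)"
    and "\<And>a b. a \<in> A \<Longrightarrow> b \<in> A \<Longrightarrow> b \<le> a \<Longrightarrow> a = b"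
  shows "minimal_monomial_gens M A"
  unfolding minimal_monomial_gens_def
proof (intro conjI allI impI notI)
  fix A' assume A': "A' \<subset> A" and eq: "ideal_gen (mon ` A') = M"
  then obtain a where a: "a \<in> A" "a \<notin> A'" by blast
  then have "(mon a :: ('n, 'k) mpoly) \<in> ideal_gen (mon ` A')"
    using eq assms(1) mon_in_ideal_gen[of a A a] by auto
  then obtain b where "b \<in> A'" "b \<le> a" unfolding mon_in_ideal_gen_iff by blast
  then show False using assms(2)[of a b] a A' by auto
qed (fact assms(1))

section \<open>Sums and products of monomial ideals, coprime generators\<close>

lemma ideal_sum_ideal_gen: "ideal_sum (ideal_gen S) (ideal_gen T) = ideal_gen (S \<union> T)"
  unfolding ideal_sum_def ideal.span_Un by simp

text \<open>A monomial of a product of polynomials is a product of their monomials, each a multiple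
  of a generator. The scalar \<open>q\<close> is absorbed into the first factor, which stays in its
  ideal.\<close>

lemma keys_ideal_prod:
  assumes "p \<in> ideal_prod (ideal_gen (mon ` A)) (ideal_gen (mon ` B) :: ('n, 'k::field) mpoly set)"
    and "c \<in> Poly_Mapping.keys p"
  shows "\<exists>u\<in>A. \<exists>v\<in>B. u + v \<le> c"
  using assms unfolding ideal_prod_def
proof (induction p rule: ideal.span_induct_alt)
  case (step q x y)
  then obtain f g where fg: "x = f * g" "f \<in> ideal_gen (mon ` A)" "g \<in> ideal_gen (mon ` B)"
    by blast
  have "c \<in> Poly_Mapping.keys (q * f * g) \<or> c \<in> Poly_Mapping.keys y"
    using subsetD[OF keys_add step.prems(1)] unfolding fg(1) mult.assoc Un_iff .
  then show ?case
  proof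
    assume "c \<in> Poly_Mapping.keys (q * f * g)"
    then obtain a b where ab: "c = a + b" "a \<in> Poly_Mapping.keys (q * f)" "b \<in> Poly_Mapping.keys g"
      using keys_mult[of "q * f" g] by blast
    obtain u where u: "u \<in> A" "u \<le> a"
      using keys_ideal_gen_mon[OF ideal.span_scale[OF fg(2)] ab(2)] by blast
    obtain v where v: "v \<in> B" "v \<le> b" using keys_ideal_gen_mon[OF fg(3) ab(3)] by blast
    have "u + v \<le> c" using u v ab(1) by (auto simp: le_fun_def intro: add_mono)
    then show ?thesis using u v by blast
  qed (rule step.IH)
qed simp

text \<open>
  The third hypothesis says \<open>lcm u v \<in> IJ\<close>; a pair of generators with a common variable
  and smallest possible lcm violates it.
\<close>

lemma coprime_of_sum_le_sup:
  fixes A B :: "('n::finite \<Rightarrow> nat) set"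
  assumes antiA: "\<And>a b. a \<in> A \<Longrightarrow> b \<in> A \<Longrightarrow> b \<le> a \<Longrightarrow> a = b"
    and antiB: "\<And>a b. a \<in> B \<Longrightarrow> b \<in> B \<Longrightarrow> b \<le> a \<Longrightarrow> a = b"
    and *: "\<And>u v. u \<in> A \<Longrightarrow> v \<in> B \<Longrightarrow> \<exists>u'\<in>A. \<exists>v'\<in>B. u' + v' \<le> sup u v"
    and "u \<in> A" "v \<in> B"
  shows "u x = 0 \<or> v x = 0"
proof (rule ccontr)
  define bad where "bad = (\<lambda>(u, v). u \<in> A \<and> v \<in> B \<and> (\<exists>x. u x \<noteq> 0 \<and> v x \<noteq> 0))"
  \<comment> \<open>The total degree of the lcm.\<close>
  define size where "size = (\<lambda>(u :: 'n \<Rightarrow> nat, v). \<Sum>x\<in>UNIV. max (u x) (v x) :: nat)"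
  assume "\<not> (u x = 0 \<or> v x = 0)"
  then have "bad (u, v)" using assms(4,5) by (auto simp: bad_def)
  then obtain p where p: "bad p" "\<And>q. bad q \<Longrightarrow> size p \<le> size q"
    using ex_has_least_nat[of bad "(u, v)" size] by blast
  obtain u v where uv: "p = (u, v)" by (cases p)
  have u: "u \<in> A" and v: "v \<in> B" and "\<exists>x. u x \<noteq> 0 \<and> v x \<noteq> 0" using p(1) by (auto simp: uv bad_def)
  then obtain z where z: "u z \<noteq> 0" "v z \<noteq> 0" by blast
  obtain u' v' where u': "u' \<in> A" and v': "v' \<in> B" and "u' + v' \<le> sup u v"
    using *[OF u v] by blast
  then have le: "u' x + v' x \<le> max (u x) (v x)" for x by (auto simp: le_fun_def sup_max)
  \<comment> \<open>At a common variable the lcm of \<open>u'\<close> and \<open>v'\<close> is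
    strictly below their product, hence below the lcm of \<open>u\<close> and \<open>v\<close>; this
    would contradict the minimal choice.\<close>
  have not_bad: "u' x = 0 \<or> v' x = 0" for x
  proof (rule ccontr)
    assume x: "\<not> (u' x = 0 \<or> v' x = 0)"
    have "size (u', v') < size (u, v)"
      unfolding size_def split
    proof (rule sum_strict_mono_ex1)
      show "\<forall>x\<in>UNIV. max (u' x) (v' x) \<le> max (u x) (v x)"
        using le by (auto intro: order_trans[OF _ le])
      have "max (u' x) (v' x) < u' x + v' x" using x by auto
      then show "\<exists>x\<in>UNIV. max (u' x) (v' x) < max (u x) (v x)" using le[of x] by (intro bexI[of _ x]) auto
    qed simp
    moreover have "bad (u', v')" using x u' v' by (auto simp: bad_def)
    ultimately show False using p(2)[of "(u', v')"] by (simp add: uv)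
  qed
  \<comment> \<open>If \<open>u' = u\<close>, the bound forces \<open>v'\<close> to divide
    \<open>v\<close>. By the antichain property they are equal, and then \<open>u'\<close> and
    \<open>v'\<close> share the variable \<open>z\<close>.\<close>
  have u_ne: "u' \<noteq> u"
  proof
    assume eq: "u' = u"
    have "v' x \<le> v x" for x using le[of x] eq by auto
    then have "v' = v" using antiB[OF v v'] by (auto simp: le_fun_def)
    then show False using not_bad[of z] z eq by simp
  qed
  have v_ne: "v' \<noteq> v"
  proof
    assume eq: "v' = v"
    have "u' x \<le> u x" for x using le[of x] eq by auto
    then have "u' = u" using antiA[OF u u'] by (auto simp: le_fun_def)
    then show False using u_ne by simp
  qed
  \<comment> \<open>The mixed pair of \<open>u\<close> and \<open>v'\<close> decides. If it is
    coprime, \<open>v'\<close> divides \<open>v\<close>, hence equals it. If not, it is bad and its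
    lcm divides that of \<open>u\<close> and \<open>v\<close>, so by minimality the two lcms agree;
    then \<open>u'\<close> divides \<open>u\<close>: where \<open>v'\<close> is 0, the lcm is
    \<open>u\<close>, and elsewhere \<open>u'\<close> is 0.\<close>
  show False
  proof (cases "\<exists>x. u x \<noteq> 0 \<and> v' x \<noteq> 0")
    case False
    have "v' x \<le> v x" for x
    proof -
      have "u x = 0 \<or> v' x = 0" using False by blast
      then show ?thesis using le[of x] by auto
    qed
    then have "v' = v" using antiB[OF v v'] by (auto simp: le_fun_def)
    then show False using v_ne by simp
  next
    case True
    have mono: "max (u x) (v' x) \<le> max (u x) (v x)" for x using le[of x] by auto
    have "max (u x) (v' x) = max (u x) (v x)" for x
    proof (rule ccontr)
      assume "max (u x) (v' x) \<noteq> max (u x) (v x)"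
      then have "size (u, v') < size (u, v)"
        unfolding size_def split using mono
        by (intro sum_strict_mono_ex1) (auto simp: le_less)
      moreover have "bad (u, v')" using True u v' by (auto simp: bad_def)
      ultimately show False using p(2)[of "(u, v')"] by (simp add: uv)
    qed
    note lcm_eq = this
    have "u' x \<le> u x" for x
      using not_bad[of x] le[of x] lcm_eq[of x] by auto
    then have "u' = u" using antiA[OF u u'] by (auto simp: le_fun_def)
    then show False using u_ne by simp
  qed
qed

text \<open>The lcm of \<open>u\<close> and \<open>v\<close> lies in both ideals, hence in their
  product, and so it is divisible by a product of generators.\<close>

lemma coprime_minimal_gens:
  assumes "minimal_monomial_gens (I :: ('n::finite, 'k::field) mpoly set) A"
    and "minimal_monomial_gens J B" and "I \<inter> J = ideal_prod I J" and "u \<in> A" "v \<in> B"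
  shows "u x = 0 \<or> v x = 0"
proof (rule coprime_of_sum_le_sup[of A B u v])
  fix u v assume uv: "u \<in> A" "v \<in> B"
  have IJ: "I = ideal_gen (mon ` A)" "J = ideal_gen (mon ` B)"
    using assms by (auto simp: minimal_monomial_gens_def)
  have "(mon (sup u v) :: ('n, 'k) mpoly) \<in> I \<inter> J"
    unfolding IJ by (intro IntI mon_in_ideal_gen[OF uv(1)] mon_in_ideal_gen[OF uv(2)]) simp_all
  then have "(mon (sup u v) :: ('n, 'k) mpoly) \<in> ideal_prod (ideal_gen (mon ` A)) (ideal_gen (mon ` B))"
    using assms(3) unfolding IJ by simp
  then show "\<exists>u'\<in>A. \<exists>v'\<in>B. u' + v' \<le> sup u v"
    by (rule keys_ideal_prod) (simp add: mon_def)
next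
  fix a b assume "a \<in> A" "b \<in> A" "b \<le> a"
  then show "a = b" by (rule minimal_monomial_gens_antichain[OF assms(1)])
next
  fix a b assume "a \<in> B" "b \<in> B" "b \<le> a"
  then show "a = b" by (rule minimal_monomial_gens_antichain[OF assms(2)])
qed (rule assms(4), rule assms(5))

section \<open>Transport of exactness and minimality along isomorphisms\<close>

lemma multigraded_hom_expand:
  fixes x :: "'b \<Rightarrow> ('n, 'k::field) mpoly"
  assumes "multigraded_hom B \<delta> C \<epsilon> f" "finite B" "x \<in> free_mod B"
  shows "f x = (\<Sum>b\<in>B. smult (x b) (f (unit_vec b)))"
proof -
  let ?t = "\<lambda>b. smult (x b) (unit_vec b)"
  have unit: "(unit_vec b :: 'b \<Rightarrow> ('n, 'k) mpoly) \<in> free_mod B" if "b \<in> B" for b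
    using that by (auto simp: free_mod_def unit_vec_def)
  have summand: "?t b \<in> free_mod B" if "b \<in> B" for b
    using unit[OF that] by (simp add: free_mod_def smult_def)
  have zero: "(0 :: 'b \<Rightarrow> ('n, 'k) mpoly) \<in> free_mod B" by (simp add: free_mod_def)
  have add: "f (x + y) = f x + f y" if "x \<in> free_mod B" "y \<in> free_mod B" for x y
    using assms(1) that unfolding multigraded_hom_def by blast
  have "f 0 + f 0 = f 0" using add[OF zero zero] unfolding add_0_left by (rule sym)
  then have f0: "f 0 = 0" by (rule add_cancel_right_right[THEN iffD1, OF sym])
  have partial: "A \<subseteq> B \<Longrightarrow> (\<Sum>b\<in>A. ?t b) \<in> free_mod B \<and> f (\<Sum>b\<in>A. ?t b) = (\<Sum>b\<in>A. smult (x b) (f (unit_vec b)))" for A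
  proof (induction A rule: infinite_finite_induct)
    case (infinite A)
    then show ?case using assms(2) finite_subset by blast
  next
    case empty
    show ?case unfolding sum.empty using zero f0 by (rule conjI)
  next
    case (insert b A)
    have b: "b \<in> B" and IH: "(\<Sum>b\<in>A. ?t b) \<in> free_mod B"
      "f (\<Sum>b\<in>A. ?t b) = (\<Sum>b\<in>A. smult (x b) (f (unit_vec b)))" using insert by auto
    have f_t: "f (?t b) = smult (x b) (f (unit_vec b))"
      using assms(1) unit[OF b] unfolding multigraded_hom_def by blast
    have "?t b + (\<Sum>b\<in>A. ?t b) \<in> free_mod B"
      using summand[OF b] IH(1) by (auto simp: free_mod_def)
    then show ?case
      unfolding sum.insert[OF insert.hyps] add[OF summand[OF b] IH(1)] IH(2) f_t by (rule conjI[OF _ refl])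
  qed
  have "x = (\<Sum>b\<in>B. ?t b)"
  proof
    fix c
    have "(\<Sum>b\<in>B. ?t b) c = (\<Sum>b\<in>B. if c = b then x b else 0)"
      unfolding sum_fun_apply by (intro sum.cong) (auto simp: smult_def unit_vec_def)
    also have "\<dots> = x c" using assms(2,3) by (auto simp: free_mod_def)
    finally show "x c = (\<Sum>b\<in>B. ?t b) c" by (rule sym)
  qed
  then have "f x = f (\<Sum>b\<in>B. ?t b)" by (rule arg_cong)
  also have "\<dots> = (\<Sum>b\<in>B. smult (x b) (f (unit_vec b)))"
    by (rule partial[OF subset_refl, THEN conjunct2])
  finally show ?thesis .
qed

text \<open>The bases of \<open>F\<close> and \<open>G\<close> need not correspond, so entries of
  the differentials cannot be matched one by one. Instead, expanding in the basis of
  \<open>F\<close> shows that the coefficients of an image under \<phi> are combinations of those of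
  its argument, hence stay in the irrelevant ideal.\<close>

lemma minimal_free_resolution_iso:
  fixes F :: "('b, 'n::finite, 'k::field) mg_complex"
  assumes "minimal_free_resolution M F" "multigraded_iso F G"
  shows "{y \<in> cmod G (Suc i). bdry G (Suc i) y = 0} \<subseteq> bdry G (Suc (Suc i)) ` cmod G (Suc (Suc i))"
    and "y \<in> cmod G (Suc i) \<Longrightarrow> c \<in> basis G i \<Longrightarrow> bdry G (Suc i) y c \<in> ideal_gen (range var)"
proof -
  from assms(2) obtain \<phi> where \<phi>: "\<forall>i. multigraded_hom (basis F i) (mdeg F i) (basis G i) (mdeg G i) (\<phi> i) \<and>
        bij_betw (\<phi> i) (cmod F i) (cmod G i)"
      "\<forall>i. \<forall>x \<in> cmod F (Suc i). bdry G (Suc i) (\<phi> (Suc i) x) = \<phi> i (bdry F (Suc i) x)"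
    unfolding multigraded_iso_def by (elim exE conjE)
  then have hom: "\<And>i. multigraded_hom (basis F i) (mdeg F i) (basis G i) (mdeg G i) (\<phi> i)"
    and bij: "\<And>i. bij_betw (\<phi> i) (cmod F i) (cmod G i)"
    and comm: "\<And>i x. x \<in> cmod F (Suc i) \<Longrightarrow> bdry G (Suc i) (\<phi> (Suc i) x) = \<phi> i (bdry F (Suc i) x)"
    by auto
  have F: "multigraded_complex F" and fin: "\<And>i. finite (basis F i)"
    and exact: "\<And>i. {x \<in> cmod F (Suc i). bdry F (Suc i) x = 0} = bdry F (Suc (Suc i)) ` cmod F (Suc (Suc i))"
    and min: "\<And>i x b. x \<in> cmod F (Suc i) \<Longrightarrow> b \<in> basis F i \<Longrightarrow> bdry F (Suc i) x b \<in> ideal_gen (range var)"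
    using assms(1) by (simp_all add: minimal_free_resolution_def free_resolution_def multigraded_complex_def)
  have bF: "bdry F (Suc i) x \<in> cmod F i" if "x \<in> cmod F (Suc i)" for i x
    using F that unfolding multigraded_complex_def multigraded_hom_def by blast
  have pre: "\<exists>x\<in>cmod F i. \<phi> i x = y" if "y \<in> cmod G i" for i y
    using that unfolding bij_betw_imp_surj_on[OF bij[of i], symmetric] by (elim imageE) (rule bexI, erule sym, assumption)
  have zero: "(0 :: 'b \<Rightarrow> ('n, 'k) mpoly) \<in> cmod F i" for i by (simp add: free_mod_def)
  have phi0: "\<phi> i 0 = 0" for i
    unfolding multigraded_hom_expand[OF hom fin zero] by (rule sum.neutral) (simp add: smult_def zero_fun_def)
  show "{y \<in> cmod G (Suc i). bdry G (Suc i) y = 0} \<subseteq> bdry G (Suc (Suc i)) ` cmod G (Suc (Suc i))"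
  proof (rule subsetI, elim CollectE conjE)
    fix y assume y: "y \<in> cmod G (Suc i)" "bdry G (Suc i) y = 0"
    obtain x where x: "x \<in> cmod F (Suc i)" "\<phi> (Suc i) x = y" using pre[OF y(1)] by blast
    have "\<phi> i (bdry F (Suc i) x) = \<phi> i 0" using comm[OF x(1)] unfolding x(2) y(2) phi0 by (rule sym)
    then have "bdry F (Suc i) x = 0"
      using inj_onD[OF bij_betw_imp_inj_on[OF bij]] bF[OF x(1)] zero by blast
    then have "x \<in> bdry F (Suc (Suc i)) ` cmod F (Suc (Suc i))" using exact[of i] x(1) by blast
    then obtain w where w: "x = bdry F (Suc (Suc i)) w" "w \<in> cmod F (Suc (Suc i))" by (rule imageE)
    have "bdry G (Suc (Suc i)) (\<phi> (Suc (Suc i)) w) = y"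
      unfolding comm[OF w(2)] w(1)[symmetric] by (rule x(2))
    moreover have "\<phi> (Suc (Suc i)) w \<in> cmod G (Suc (Suc i))"
      using bij_betw_apply[OF bij w(2)] .
    ultimately show "y \<in> bdry G (Suc (Suc i)) ` cmod G (Suc (Suc i))" by blast
  qed
  show "bdry G (Suc i) y c \<in> ideal_gen (range var)" if y: "y \<in> cmod G (Suc i)" for y
  proof -
    obtain x where x: "x \<in> cmod F (Suc i)" "\<phi> (Suc i) x = y" using pre[OF y] by blast
    have "bdry G (Suc i) y = \<phi> i (bdry F (Suc i) x)" using comm[OF x(1)] unfolding x(2) .
    also have "\<dots> = (\<Sum>b\<in>basis F i. smult (bdry F (Suc i) x b) (\<phi> i (unit_vec b)))"
      by (rule multigraded_hom_expand[OF hom fin bF[OF x(1)]])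
    finally have eq: "bdry G (Suc i) y c = (\<Sum>b\<in>basis F i. \<phi> i (unit_vec b) c * bdry F (Suc i) x b)"
      by (simp only: sum_fun_apply smult_def mult.commute)
    show ?thesis
      unfolding eq by (intro ideal.span_sum ideal.span_scale min x(1))
  qed
qed

section \<open>The resolution of the sum\<close>

lemma face_in_facet:
  assumes "simplicial_complex V \<Delta>" "\<sigma> \<in> \<Delta>"
  obtains \<tau> where "\<tau> \<in> facets \<Delta>" "\<sigma> \<subseteq> \<tau>"
proof -
  obtain \<tau> where "\<tau> \<in> \<Delta>" "\<sigma> \<subseteq> \<tau>" "\<forall>\<rho>\<in>\<Delta>. \<tau> \<subseteq> \<rho> \<longrightarrow> \<tau> = \<rho>"
    using finite_has_maximal2[OF simplicial_complex_finite_faces[OF assms(1)] assms(2)] by blast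
  then show ?thesis by (intro that[of \<tau>]) (auto simp: facets_def)
qed

text \<open>Since the vertex sets are disjoint, each part of a face lies in the facet of its own
  factor; conversely, by finiteness each part extends to a facet.\<close>

lemma join_iff:
  assumes "simplicial_complex V1 \<Delta>1" "simplicial_complex V2 \<Delta>2" "V1 \<inter> V2 = {}"
  shows "\<sigma> \<in> join \<Delta>1 \<Delta>2 \<longleftrightarrow> \<sigma> \<subseteq> V1 \<union> V2 \<and> \<sigma> \<inter> V1 \<in> \<Delta>1 \<and> \<sigma> \<inter> V2 \<in> \<Delta>2"
proof
  assume "\<sigma> \<in> join \<Delta>1 \<Delta>2"
  then obtain \<sigma>1 \<sigma>2 where s: "\<sigma>1 \<in> \<Delta>1" "\<sigma>2 \<in> \<Delta>2" "\<sigma> \<subseteq> \<sigma>1 \<union> \<sigma>2"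
    by (auto simp: join_def facets_def)
  then have sub: "\<sigma>1 \<subseteq> V1" "\<sigma>2 \<subseteq> V2"
    using simplicial_complex_subset assms(1,2) by auto
  then have "\<sigma> \<inter> V1 \<subseteq> \<sigma>1" "\<sigma> \<inter> V2 \<subseteq> \<sigma>2" using s assms(3) by auto
  then show "\<sigma> \<subseteq> V1 \<union> V2 \<and> \<sigma> \<inter> V1 \<in> \<Delta>1 \<and> \<sigma> \<inter> V2 \<in> \<Delta>2"
    using s sub simplicial_complex_downD[OF assms(1) s(1)] simplicial_complex_downD[OF assms(2) s(2)] by auto
next
  assume *: "\<sigma> \<subseteq> V1 \<union> V2 \<and> \<sigma> \<inter> V1 \<in> \<Delta>1 \<and> \<sigma> \<inter> V2 \<in> \<Delta>2"
  obtain \<tau>1 where 1: "\<tau>1 \<in> facets \<Delta>1" "\<sigma> \<inter> V1 \<subseteq> \<tau>1" using face_in_facet[OF assms(1)] * by blast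
  obtain \<tau>2 where 2: "\<tau>2 \<in> facets \<Delta>2" "\<sigma> \<inter> V2 \<subseteq> \<tau>2" using face_in_facet[OF assms(2)] * by blast
  have "\<sigma> \<subseteq> \<tau>1 \<union> \<tau>2" using * 1(2) 2(2) by auto
  then show "\<sigma> \<in> join \<Delta>1 \<Delta>2" unfolding join_def using 1(1) 2(1) by blast
qed

lemma simplicial_complex_faces_below:
  assumes "simplicial_complex V \<Delta>" shows "simplicial_complex V (faces_below m \<Delta> a)"
proof -
  have "\<tau> \<in> faces_below m \<Delta> a" if "\<sigma> \<in> faces_below m \<Delta> a" "\<tau> \<subseteq> \<sigma>" for \<sigma> \<tau>
    using that simplicial_complex_downD[OF assms, of \<sigma> \<tau>]
      face_deg_mono[OF simplicial_complex_finite[OF assms, of \<sigma>], of \<tau> m]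
    by (auto simp: faces_below_def intro: order_trans)
  moreover have "\<forall>\<sigma>\<in>faces_below m \<Delta> a. \<sigma> \<subseteq> V"
    using simplicial_complex_subset[OF assms] by (auto simp: faces_below_def)
  ultimately show ?thesis
    using assms by (simp add: simplicial_complex_def)
qed

text \<open>Whether a face monomial divides \<open>x^a\<close> is decided vertex by vertex, hence on
  the two parts of a face separately.\<close>

lemma ordered_join_faces_below:
  assumes "ordered_join V1 V2 \<Delta>1 \<Delta>2 \<Delta>"
  shows "ordered_join V1 V2 (faces_below m \<Delta>1 a) (faces_below m \<Delta>2 a) (faces_below m \<Delta> a)"
proof -
  interpret ordered_join V1 V2 \<Delta>1 \<Delta>2 \<Delta> by fact
  show ?thesis
  proof
    show "simplicial_complex V1 (faces_below m \<Delta>1 a)" "simplicial_complex V2 (faces_below m \<Delta>2 a)"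
      using complex1 complex2 by (simp_all add: simplicial_complex_faces_below)
    show "i < j" if "i \<in> V1" "j \<in> V2" for i j using that by (rule ordered)
    show "\<sigma> \<in> faces_below m \<Delta> a \<longleftrightarrow>
        \<sigma> \<subseteq> V1 \<union> V2 \<and> \<sigma> \<inter> V1 \<in> faces_below m \<Delta>1 a \<and> \<sigma> \<inter> V2 \<in> faces_below m \<Delta>2 a" for \<sigma>
    proof (cases "\<sigma> \<subseteq> V1 \<union> V2")
      case True
      have "face_deg m \<sigma> \<le> a \<longleftrightarrow> face_deg m (\<sigma> \<inter> V1) \<le> a \<and> face_deg m (\<sigma> \<inter> V2) \<le> a"
        using True finite_vertices finite_subset[OF True] by (auto simp: face_deg_le_iff)
      then show ?thesis using True by (auto simp: faces_below_def face_iff)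
    qed (simp add: faces_below_def face_iff)
  qed
qed

text \<open>Some exponent of the lcm drops when \<open>j\<close> leaves \<rho>. The variable
  \<open>x\<close> concerned occurs in \<open>m j\<close>, so by coprimality in no label of \<tau>,
  and adding \<tau> cannot restore the exponent.\<close>

lemma face_deg_remove_neq:
  assumes "finite \<rho>" "finite \<tau>" "j \<in> \<rho>" "j \<notin> \<tau>" "face_deg m (\<rho> - {j}) \<noteq> face_deg m \<rho>"
    and coprime: "\<And>k x. k \<in> \<tau> \<Longrightarrow> m j x = 0 \<or> m k x = 0"
  shows "face_deg m (\<rho> \<union> \<tau> - {j}) \<noteq> face_deg m (\<rho> \<union> \<tau>)"
proof
  assume eq: "face_deg m (\<rho> \<union> \<tau> - {j}) = face_deg m (\<rho> \<union> \<tau>)"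
  have "face_deg m (\<rho> - {j}) \<le> face_deg m \<rho>" using assms(1) by (intro face_deg_mono) auto
  then have "\<not> face_deg m \<rho> \<le> face_deg m (\<rho> - {j})" using assms(5) by auto
  then obtain x where x: "\<not> face_deg m \<rho> x \<le> face_deg m (\<rho> - {j}) x" by (auto simp: le_fun_def)
  let ?t = "face_deg m (\<rho> - {j}) x"
  have le: "\<forall>i\<in>\<rho> - {j}. m i x \<le> ?t"
    using face_deg_apply_le_iff[of "\<rho> - {j}" m x ?t] assms(1) by simp
  have "\<not> (\<forall>i\<in>\<rho>. m i x \<le> ?t)"
    using face_deg_apply_le_iff[OF assms(1), of m x ?t] x by simp
  then have "m j x > ?t" using le by (metis DiffI linorder_not_le singletonD)
  then have "m j x \<noteq> 0" by linarith
  then have "\<forall>k\<in>\<tau>. m k x = 0" using coprime[of _ x] by auto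
  then have "\<forall>i\<in>\<rho> \<union> \<tau> - {j}. m i x \<le> ?t" using le by auto
  then have "face_deg m (\<rho> \<union> \<tau> - {j}) x \<le> ?t"
    using face_deg_apply_le_iff[of "\<rho> \<union> \<tau> - {j}" m x ?t] assms(1,2) by simp
  then have "face_deg m (\<rho> \<union> \<tau>) x \<le> ?t" using eq by simp
  moreover have "face_deg m \<rho> \<le> face_deg m (\<rho> \<union> \<tau>)" using assms by (intro face_deg_mono) auto
  then have "face_deg m \<rho> x \<le> face_deg m (\<rho> \<union> \<tau>) x" by (simp add: le_fun_def)
  ultimately show False using x by (meson order_trans)
qed

section \<open>From minimality to strict divisibility\<close>

lemma face_deg_empty [simp]: "face_deg m {} = 0"
  by (simp add: face_deg.simps)

lemma face_deg_singleton [simp]: "face_deg m {v} = m v"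
  by (simp add: face_deg.simps)

text \<open>If the degrees agreed, the boundary of the basis vector of \<sigma> would have the entry
  1 or -1 at \<open>\<sigma> - {j}\<close>, with nonzero constant term.\<close>

lemma face_deg_neq_of_minimal:
  assumes "simplicial_complex V \<Delta>" "\<sigma> \<in> \<Delta>" "j \<in> \<sigma>"
    and min: "\<And>i (y :: nat set \<Rightarrow> ('n::finite, 'k::field) mpoly) c.
      y \<in> free_mod {\<sigma> \<in> \<Delta>. card \<sigma> = Suc i} \<Longrightarrow> c \<in> \<Delta> \<Longrightarrow> card c = i \<Longrightarrow>
      bdry (homogenization m \<Delta>) (Suc i) y c \<in> ideal_gen (range var)"
  shows "face_deg m (\<sigma> - {j}) \<noteq> face_deg m \<sigma>"
proof
  assume eq: "face_deg m (\<sigma> - {j}) = face_deg m \<sigma>"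
  let ?\<tau> = "\<sigma> - {j}"
  let ?y = "unit_vec \<sigma> :: nat set \<Rightarrow> ('n, 'k) mpoly"
  have fin: "finite \<sigma>" by (rule simplicial_complex_finite[OF assms(1,2)])
  have y: "?y \<in> free_mod {\<sigma> \<in> \<Delta>. card \<sigma> = Suc (card ?\<tau>)}"
    using assms(2,3) fin card.remove[OF fin assms(3)] by (auto simp: free_mod_def unit_vec_def)
  have jV: "j \<in> V - ?\<tau>" "finite V"
    using simplicial_complex_subset[OF assms(1,2)] assms(1,3) by (auto simp: simplicial_complex_def)
  have ins: "insert k ?\<tau> = \<sigma> \<longleftrightarrow> k = j" if "k \<in> V - ?\<tau>" for k using assms(3) that by auto
  have "bdry (homogenization m \<Delta>) (Suc (card ?\<tau>)) ?y ?\<tau> =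
      (\<Sum>k\<in>V - ?\<tau>. if k = j then face_sign j ?\<tau> * mon 0 else 0)"
    unfolding homogenization_bdry_apply[OF assms(1) y]
  proof (rule sum.cong[OF refl])
    fix k assume k: "k \<in> V - ?\<tau>"
    show "?y (insert k ?\<tau>) * (face_sign k ?\<tau> * mon (face_deg m (insert k ?\<tau>) - face_deg m ?\<tau>)) =
      (if k = j then face_sign j ?\<tau> * mon 0 else 0)"
    proof (cases "k = j")
      case True
      have "face_deg m \<sigma> - face_deg m \<sigma> = 0" by (simp add: fun_eq_iff)
      then show ?thesis using True ins[OF k] eq by (simp add: unit_vec_def)
    next
      case False
      then show ?thesis using ins[OF k] by (simp add: unit_vec_def)
    qed
  qed
  also have "\<dots> = face_sign j ?\<tau> * mon 0" using jV by simp
  finally have "face_sign j ?\<tau> * mon 0 \<in> ideal_gen (range var :: ('n, 'k) mpoly set)"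
    using min[OF y, of ?\<tau>] simplicial_complex_downD[OF assms(1,2), of ?\<tau>] by auto
  then have "Poly_Mapping.lookup (face_sign j ?\<tau> * mon 0 :: ('n, 'k) mpoly) 0 = 0"
    by (rule lookup_zero_of_irrelevant)
  then show False
    unfolding face_sign_def lookup_minus_one_power_mult by (simp add: mon_def)
qed

section \<open>Recognizing a minimal free resolution\<close>

lemma coset_mem: "p \<in> coset (ideal_gen S) q \<longleftrightarrow> p - q \<in> ideal_gen S"
  unfolding coset_def by (force simp: algebra_simps)

lemma coset_eq_iff: "coset (ideal_gen S) p = coset (ideal_gen S) q \<longleftrightarrow> p - q \<in> ideal_gen S"
proof
  assume "coset (ideal_gen S) p = coset (ideal_gen S) q"
  moreover have "p \<in> coset (ideal_gen S) p" unfolding coset_mem by (simp add: ideal.span_zero)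
  ultimately show "p - q \<in> ideal_gen S" unfolding coset_mem[symmetric] by simp
next
  assume pq: "p - q \<in> ideal_gen S"
  have "x - p \<in> ideal_gen S \<longleftrightarrow> x - q \<in> ideal_gen S" for x
    using ideal.span_add_eq[OF pq, of "x - p"] by (simp add: add.commute)
  then show "coset (ideal_gen S) p = coset (ideal_gen S) q" by (auto simp: coset_mem)
qed

text \<open>Injectivity allows the coefficients to be indexed by vertices instead of monomials, as
  in the module of degree 1.\<close>

lemma ideal_gen_mon_finite:
  assumes "finite V" "inj_on m V"
  shows "p \<in> ideal_gen (mon ` m ` V) \<longleftrightarrow> (\<exists>f. p = (\<Sum>v\<in>V. f v * (mon (m v) :: ('n, 'k::field) mpoly)))"
proof -
  let ?g = "\<lambda>v. mon (m v) :: ('n, 'k) mpoly"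
  have inj: "inj_on ?g V" using assms(2) by (auto simp: inj_on_def)
  have "mon ` m ` V = ?g ` V" by auto
  then have span: "ideal_gen (mon ` m ` V) = range (\<lambda>u. \<Sum>v\<in>V. u (?g v) * ?g v)"
    using ideal.span_finite[of "?g ` V"] assms(1) by (simp add: sum.reindex[OF inj])
  show ?thesis
  proof
    assume "p \<in> ideal_gen (mon ` m ` V)"
    then obtain u where "p = (\<Sum>v\<in>V. u (?g v) * ?g v)" unfolding span by (rule rangeE)
    then show "\<exists>f. p = (\<Sum>v\<in>V. f v * ?g v)" by (rule exI[of _ "\<lambda>v. u (?g v)"])
  next
    assume "\<exists>f. p = (\<Sum>v\<in>V. f v * ?g v)"
    then obtain f where f: "p = (\<Sum>v\<in>V. f v * ?g v)" by (rule exE)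
    have "p = (\<Sum>v\<in>V. (f \<circ> the_inv_into V ?g) (?g v) * ?g v)"
      unfolding f by (intro sum.cong refl) (simp add: the_inv_into_f_f[OF inj])
    then show "p \<in> ideal_gen (mon ` m ` V)" unfolding span by (rule range_eqI[of _ _ "f \<circ> the_inv_into V ?g"])
  qed
qed

text \<open>The boundary from degree 1 sends the vertex \<open>v\<close> to its monomial, so its
  image is \<open>M\<close>. Higher exactness comes from the strands, and strict divisibility makes
  every nonzero entry of the differential a multiple of a variable.\<close>

lemma minimal_free_resolution_homogenization:
  fixes M :: "('n::finite, 'k::field) mpoly set"
  assumes complex: "simplicial_complex V \<Delta>" and "{} \<in> \<Delta>" and vertices: "\<And>v. v \<in> V \<Longrightarrow> {v} \<in> \<Delta>"
    and inj: "inj_on m V" and M: "M = ideal_gen (mon ` m ` V)"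
    and acyclic: "\<And>i a. acyclic_at TYPE('k) V (faces_below m \<Delta> a) (Suc i)"
    and min: "\<And>\<sigma> j. \<sigma> \<in> \<Delta> \<Longrightarrow> j \<in> \<sigma> \<Longrightarrow> face_deg m (\<sigma> - {j}) \<noteq> face_deg m \<sigma>"
  shows "minimal_free_resolution M (homogenization m \<Delta> :: (nat set, 'n, 'k) mg_complex)"
    (is "minimal_free_resolution M ?H")
proof -
  let ?C = "\<lambda>i. free_mod {\<sigma> \<in> \<Delta>. card \<sigma> = i} :: (nat set \<Rightarrow> ('n, 'k) mpoly) set"
  have mgc: "multigraded_complex ?H" by (rule homogenization_multigraded_complex[OF complex])
  have V: "finite V" using complex by (simp add: simplicial_complex_def)
  have bdry_in: "bdry ?H (Suc i) x \<in> ?C i" if "x \<in> ?C (Suc i)" for i x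
    using mgc that unfolding multigraded_complex_def multigraded_hom_def homogenization_sel by blast
  have exact: "{x \<in> ?C (Suc i). bdry ?H (Suc i) x = 0} = bdry ?H (Suc (Suc i)) ` ?C (Suc (Suc i))" for i
  proof
    show "{x \<in> ?C (Suc i). bdry ?H (Suc i) x = 0} \<subseteq> bdry ?H (Suc (Suc i)) ` ?C (Suc (Suc i))"
      using homogenization_exact_iff[OF complex, of i m, where ?'k = 'k] acyclic by blast
    show "bdry ?H (Suc (Suc i)) ` ?C (Suc (Suc i)) \<subseteq> {x \<in> ?C (Suc i). bdry ?H (Suc i) x = 0}"
      using mgc bdry_in unfolding multigraded_complex_def homogenization_sel by blast
  qed
  have deg0: "{\<sigma> \<in> \<Delta>. card \<sigma> = 0} = {{}}"
    using \<open>{} \<in> \<Delta>\<close> simplicial_complex_finite[OF complex] by auto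
  have bdry1: "bdry ?H (Suc 0) y {} = (\<Sum>v\<in>V. y {v} * mon (m v))" if "y \<in> ?C (Suc 0)" for y
    unfolding homogenization_bdry_apply[OF complex that] Diff_empty
  proof (intro sum.cong refl)
    fix v assume "v \<in> V"
    have "m v - 0 = m v" by (simp add: fun_eq_iff)
    then show "y {v} * (face_sign v {} * mon (face_deg m {v} - face_deg m {})) = y {v} * mon (m v)"
      unfolding face_deg_empty face_deg_singleton by (simp add: face_sign_def)
  qed
  have image: "x {} \<in> M \<longleftrightarrow> x \<in> bdry ?H (Suc 0) ` ?C (Suc 0)" if x: "x \<in> ?C 0" for x
  proof
    assume "x {} \<in> M"
    then obtain f where f: "x {} = (\<Sum>v\<in>V. f v * mon (m v))"
      unfolding M ideal_gen_mon_finite[OF V inj] by blast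
    \<comment> \<open>The coefficient of a generator becomes that of its vertex;
      \<open>vertices\<close> ensures that no term is lost.\<close>
    define y where "y = (\<lambda>\<sigma>. if \<sigma> \<in> \<Delta> \<and> card \<sigma> = Suc 0 then f (the_elem \<sigma>) else 0)"
    have y: "y \<in> ?C (Suc 0)" by (simp add: y_def free_mod_def)
    have "bdry ?H (Suc 0) y = x"
    proof
      fix \<sigma>
      show "bdry ?H (Suc 0) y \<sigma> = x \<sigma>"
      proof (cases "\<sigma> = {}")
        case True
        have "(\<Sum>v\<in>V. y {v} * mon (m v)) = (\<Sum>v\<in>V. f v * mon (m v))"
          by (intro sum.cong refl) (simp add: y_def vertices)
        then show ?thesis unfolding True bdry1[OF y] f .
      next
        case False
        then show ?thesis using bdry_in[OF y] x unfolding deg0 by (simp add: free_mod_def)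
      qed
    qed
    then show "x \<in> bdry ?H (Suc 0) ` ?C (Suc 0)" using y by blast
  next
    assume "x \<in> bdry ?H (Suc 0) ` ?C (Suc 0)"
    then obtain y where y: "x = bdry ?H (Suc 0) y" "y \<in> ?C (Suc 0)" by (rule imageE)
    have "x {} = (\<Sum>v\<in>V. y {v} * mon (m v))" unfolding y(1) by (rule bdry1[OF y(2)])
    then show "x {} \<in> M" unfolding M ideal_gen_mon_finite[OF V inj] by (rule exI[of _ "\<lambda>v. y {v}"])
  qed
  \<comment> \<open>The module of degree 0 is \<open>R\<close> itself, on the empty face, and the
    augmentation is the quotient map.\<close>
  have "augmentation M ?H (\<lambda>x. coset M (x {}))"
    unfolding augmentation_def homogenization_sel
  proof (intro conjI ballI allI)
    show "(\<lambda>x. coset M (x {})) ` ?C 0 = range (coset M)"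
    proof (intro equalityI subsetI)
      fix c assume "c \<in> range (coset M)"
      then obtain p where p: "c = coset M p" by blast
      let ?x = "\<lambda>\<sigma>::nat set. if \<sigma> = {} then p else 0"
      have "?x \<in> ?C 0" unfolding deg0 by (simp add: free_mod_def)
      then show "c \<in> (\<lambda>x. coset M (x {})) ` ?C 0" unfolding p by (rule rev_image_eqI) simp
    qed auto
  next
    fix x y :: "nat set \<Rightarrow> ('n, 'k) mpoly" and p q
    assume "p \<in> coset M (x {})" "q \<in> coset M (y {})"
    then have "(p - x {}) + (q - y {}) \<in> M" unfolding M coset_mem by (rule ideal.span_add)
    then have "- ((p - x {}) + (q - y {})) \<in> M" unfolding M by (rule ideal.span_neg)
    then show "coset M ((x + y) {}) = coset M (p + q)"
      unfolding M coset_eq_iff by (simp add: algebra_simps)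
  next
    fix r p and x :: "nat set \<Rightarrow> ('n, 'k) mpoly"
    assume "p \<in> coset M (x {})"
    then have "(- r) * (p - x {}) \<in> M" unfolding M coset_mem by (rule ideal.span_scale)
    moreover have "(- r) * (p - x {}) = r * x {} - r * p" by (simp add: right_diff_distrib)
    ultimately show "coset M (smult r x {}) = coset M (r * p)"
      unfolding M coset_eq_iff smult_def by simp
  next
    fix a and x :: "nat set \<Rightarrow> ('n, 'k) mpoly"
    assume x: "x \<in> graded_part {\<sigma> \<in> \<Delta>. card \<sigma> = 0} (face_deg m) a"
    have "c = a" if "c \<in> Poly_Mapping.keys (x {})" for c
    proof -
      have "c + face_deg m {} = a" using x that unfolding deg0 graded_part_def by blast
      then show ?thesis by (simp only: face_deg_empty add_0_right)
    qed
    then show "\<exists>p. Poly_Mapping.keys p \<subseteq> {a} \<and> coset M (x {}) = coset M p" by blast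
  next
    show "{x \<in> ?C 0. coset M (x {}) = coset M 0} = bdry ?H 1 ` ?C 1"
    proof -
      have "coset M (x {}) = coset M 0 \<longleftrightarrow> x {} \<in> M" for x :: "nat set \<Rightarrow> ('n, 'k) mpoly"
        unfolding M coset_eq_iff diff_zero ..
      then show ?thesis using image bdry_in[of _ 0] unfolding One_nat_def by blast
    qed
  qed
  then have "free_resolution M ?H"
    unfolding free_resolution_def homogenization_sel using mgc exact by blast
  moreover have "bdry ?H (Suc i) x \<tau> \<in> ideal_gen (range var)" if x: "x \<in> ?C (Suc i)" for i x \<tau>
    unfolding homogenization_bdry_apply[OF complex x]
  proof (intro ideal.span_sum)
    fix j assume j: "j \<in> V - \<tau>"
    show "x (insert j \<tau>) * (face_sign j \<tau> * mon (face_deg m (insert j \<tau>) - face_deg m \<tau>)) \<in> ideal_gen (range var)"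
    proof (cases "insert j \<tau> \<in> \<Delta>")
      case True
      have le: "face_deg m \<tau> \<le> face_deg m (insert j \<tau>)"
        by (rule face_deg_mono[OF simplicial_complex_finite[OF complex True]]) auto
      have "insert j \<tau> - {j} = \<tau>" using j by auto
      then have "face_deg m \<tau> \<noteq> face_deg m (insert j \<tau>)" using min[OF True, of j] by simp
      then have "face_deg m (insert j \<tau>) - face_deg m \<tau> \<noteq> 0"
        using exponent_add_diff[OF le] by (metis add_0_right)
      then show ?thesis by (intro ideal.span_scale mon_irrelevant)
    next
      case False
      then have "x (insert j \<tau>) = 0" using x by (simp add: free_mod_def)
      then show ?thesis by (simp add: ideal.span_zero)
    qed
  qed
  ultimately show ?thesis unfolding minimal_free_resolution_def homogenization_sel by blast
qed

lemma multigraded_iso_refl: "multigraded_iso F F"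
  unfolding multigraded_iso_def
  by (rule exI[of _ "\<lambda>_ x. x"]) (auto simp: multigraded_hom_def bij_betw_def inj_on_def)

text \<open>Everything needed from the given resolution, reduced to properties of
  \<open>\<Delta>\<close> and the labels.\<close>

lemma supported_by_homogenization:
  assumes "minimal_free_resolution M F" "supported_by (M :: ('n::finite, 'k::field) mpoly set) V m \<Delta> F"
  shows "acyclic_at TYPE('k) V (faces_below m \<Delta> a) (Suc i)"
    and "\<sigma> \<in> \<Delta> \<Longrightarrow> j \<in> \<sigma> \<Longrightarrow> face_deg m (\<sigma> - {j}) \<noteq> face_deg m \<sigma>"
proof -
  have complex: "simplicial_complex V \<Delta>" and iso: "multigraded_iso F (homogenization m \<Delta>)"
    using assms(2) by (auto simp: supported_by_def)
  note res = minimal_free_resolution_iso[OF assms(1) iso, unfolded homogenization_sel]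
  show "acyclic_at TYPE('k) V (faces_below m \<Delta> a) (Suc i)"
    using homogenization_exact_iff[OF complex] res(1) by blast
  show "face_deg m (\<sigma> - {j}) \<noteq> face_deg m \<sigma>" if "\<sigma> \<in> \<Delta>" "j \<in> \<sigma>"
    by (rule face_deg_neq_of_minimal[OF complex that]) (rule res(2), auto)
qed

theorem theorem4p3:
  fixes I J :: "('n::finite, 'k::field) mpoly set"
    and m :: "nat \<Rightarrow> 'n \<Rightarrow> nat"
    and r s :: nat
    and \<Delta>\<^sub>I \<Delta>\<^sub>J :: "nat set set"
    and F\<^sub>I :: "('b, 'n, 'k) mg_complex"
    and F\<^sub>J :: "('c, 'n, 'k) mg_complex"
  assumes "monomial_ideal I" and "monomial_ideal J"
    and "I \<inter> J = ideal_prod I J"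
    and "minimal_monomial_gens I (m ` {1..r})" and "card (m ` {1..r}) = r"
    and "minimal_monomial_gens J (m ` {r+1..r+s})" and "card (m ` {r+1..r+s}) = s"
    and "minimal_free_resolution I F\<^sub>I" and "supported_by I {1..r} m \<Delta>\<^sub>I F\<^sub>I"
    and "minimal_free_resolution J F\<^sub>J" and "supported_by J {r+1..r+s} m \<Delta>\<^sub>J F\<^sub>J"
  shows "\<exists>F :: (nat set, 'n, 'k) mg_complex.
           minimal_free_resolution (ideal_sum I J) F \<and>
           supported_by (ideal_sum I J) {1..r+s} m (join \<Delta>\<^sub>I \<Delta>\<^sub>J) F"
proof -
  define V1 V2 where "V1 = {1..r}" and "V2 = {r+1..r+s}"
  have V: "{1..r+s} = V1 \<union> V2" by (auto simp: V1_def V2_def)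
  have ord: "i < j" if "i \<in> V1" "j \<in> V2" for i j using that by (auto simp: V1_def V2_def)
  note gens1 = assms(4)[folded V1_def] and gens2 = assms(6)[folded V2_def]
  note supp1 = assms(9)[folded V1_def] and supp2 = assms(11)[folded V2_def]
  have complex1: "simplicial_complex V1 \<Delta>\<^sub>I" and e1: "{} \<in> \<Delta>\<^sub>I" and v1: "\<And>v. v \<in> V1 \<Longrightarrow> {v} \<in> \<Delta>\<^sub>I"
    and inj1: "inj_on m V1"
    using supp1 by (simp_all add: supported_by_def)
  have complex2: "simplicial_complex V2 \<Delta>\<^sub>J" and e2: "{} \<in> \<Delta>\<^sub>J" and v2: "\<And>v. v \<in> V2 \<Longrightarrow> {v} \<in> \<Delta>\<^sub>J"
    and inj2: "inj_on m V2"
    using supp2 by (simp_all add: supported_by_def)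
  have disj: "V1 \<inter> V2 = {}" using ord by blast
  interpret J: ordered_join V1 V2 \<Delta>\<^sub>I \<Delta>\<^sub>J "join \<Delta>\<^sub>I \<Delta>\<^sub>J"
    by unfold_locales (use complex1 complex2 ord join_iff[OF complex1 complex2 disj] in auto)
  note res1 = supported_by_homogenization[OF assms(8) supp1]
    and res2 = supported_by_homogenization[OF assms(10) supp2]
  have acyclic: "acyclic_at TYPE('k) (V1 \<union> V2) (faces_below m (join \<Delta>\<^sub>I \<Delta>\<^sub>J) a) (Suc i)" for a i
    by (rule ordered_join.acyclic_at_join[OF ordered_join_faces_below[OF J.ordered_join_axioms]])
       (rule res1(1), rule res2(1))
  have coprime: "m u x = 0 \<or> m v x = 0" if "u \<in> V1" "v \<in> V2" for u v x
    by (rule coprime_minimal_gens[OF gens1 gens2 assms(3)]) (use that in auto)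
  have min: "face_deg m (\<sigma> - {j}) \<noteq> face_deg m \<sigma>" if \<sigma>: "\<sigma> \<in> join \<Delta>\<^sub>I \<Delta>\<^sub>J" "j \<in> \<sigma>" for \<sigma> j
  proof -
    have sub: "\<sigma> \<subseteq> V1 \<union> V2" "\<sigma> \<inter> V1 \<in> \<Delta>\<^sub>I" "\<sigma> \<inter> V2 \<in> \<Delta>\<^sub>J" using \<sigma>(1) by (simp_all add: J.face_iff)
    have fin: "finite (\<sigma> \<inter> V1)" "finite (\<sigma> \<inter> V2)" using J.finite_vertices by auto
    have eq: "\<sigma> \<inter> V1 \<union> \<sigma> \<inter> V2 = \<sigma>" "\<sigma> \<inter> V2 \<union> \<sigma> \<inter> V1 = \<sigma>" using sub(1) by auto
    consider "j \<in> V1" "j \<notin> V2" | "j \<in> V2" "j \<notin> V1" using sub(1) \<sigma>(2) disj by blast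
    then show ?thesis
    proof cases
      case 1
      show ?thesis
        using face_deg_remove_neq[OF fin, of j m, OF _ _ res1(2)[OF sub(2)]] 1 \<sigma>(2) coprime unfolding eq by auto
    next
      case 2
      have c: "m j x = 0 \<or> m k x = 0" if "k \<in> V1" for k x using coprime[OF that 2(1), of x] by (rule disj_commute[THEN iffD1])
      show ?thesis
        using face_deg_remove_neq[OF fin(2,1), of j m, OF _ _ res2(2)[OF sub(3)]] 2 \<sigma>(2) c unfolding eq by auto
    qed
  qed
  \<comment> \<open>Strictness for the face \<open>{v}\<close>: removing \<open>v\<close> leaves the
    empty face, of degree 0.\<close>
  have nonzero: "m v \<noteq> 0" if "v \<in> V1 \<union> V2" for v
    using that res1(2)[OF v1, of v v] res2(2)[OF v2, of v v] by auto
  \<comment> \<open>A label dividing one of the other block would share all its variables with it,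
    so by coprimality it would be the monomial 1.\<close>
  have not_le: "\<not> m u \<le> m v" if "u \<in> V1 \<and> v \<in> V2 \<or> u \<in> V2 \<and> v \<in> V1" for u v
  proof
    assume "m u \<le> m v"
    then have "m u x \<le> m v x" for x by (simp add: le_fun_def)
    then have "m u x = 0" for x using that coprime[of u v x] coprime[of v u x] by (metis le_zero_eq)
    then show False using nonzero[of u] that by (auto simp: fun_eq_iff)
  qed
  have antichain: "m u = m v" if "u \<in> V1 \<union> V2" "v \<in> V1 \<union> V2" "m v \<le> m u" for u v
    using that not_le[of v u] minimal_monomial_gens_antichain[OF gens1, of "m u" "m v"]
      minimal_monomial_gens_antichain[OF gens2, of "m u" "m v"] by blast
  \<comment> \<open>Equal labels in different blocks would divide each other.\<close>
  have inj: "inj_on m (V1 \<union> V2)"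
    using inj1 inj2 not_le unfolding inj_on_def by (metis Un_iff order_refl)
  have IJ: "ideal_sum I J = ideal_gen (mon ` m ` (V1 \<union> V2))"
    using gens1 gens2 ideal_sum_ideal_gen[of "mon ` m ` V1 :: ('n, 'k) mpoly set" "mon ` m ` V2"]
    by (simp add: minimal_monomial_gens_def image_Un)
  have e: "{} \<in> join \<Delta>\<^sub>I \<Delta>\<^sub>J" using e1 e2 by (simp add: J.face_iff)
  have v: "{v} \<in> join \<Delta>\<^sub>I \<Delta>\<^sub>J" if "v \<in> V1 \<union> V2" for v
  proof (cases "v \<in> V1")
    case True
    then have "{v} \<inter> V2 = {}" using disj by auto
    then show ?thesis using True v1 e2 by (simp add: J.face_iff)
  next
    case False
    then show ?thesis using that v2 e1 by (simp add: J.face_iff)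
  qed
  \<comment> \<open>The homogenization itself is the witness, so the isomorphism required for
    support is the identity.\<close>
  have "minimal_free_resolution (ideal_sum I J) (homogenization m (join \<Delta>\<^sub>I \<Delta>\<^sub>J) :: (nat set, 'n, 'k) mg_complex)"
    by (rule minimal_free_resolution_homogenization[OF J.complex_join e v inj IJ acyclic min])
  moreover have "minimal_monomial_gens (ideal_sum I J) (m ` (V1 \<union> V2))"
    by (rule minimal_monomial_gensI[OF IJ[symmetric]]) (use antichain in blast)
  ultimately show ?thesis
    unfolding V supported_by_def using inj J.complex_join e v multigraded_iso_refl by blast
qed

end
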